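(* Let $G=(V,E)$ be a finite connected Eulerian directed multigraph and let $\alpha$ be a probability distribution on $V$ with $\alpha_i>0$ for all $i\in V$. For an initial sandpile $s_0:V\to\mathbb{Z}$ let $(s_k)_{k\ge0}$ be the closed chain started at $s_0$ and driven by the i.i.d. sequence $i_1,i_2,\ldots$ with law $\alpha$, and let $\tau=\min\{k\ge0: s_k\text{ is not stabilizable}\}$. Then for any $z\in V$ and any $\rho\in\mathrm{Rec}(z)$, as $|s_0|\to-\infty$, $$\mathbb{P}_{s_0}\{R_z(s_\tau)=\rho\}\;\to\;\frac1\kappa\sum_{i\in V}\alpha_i\,\mathrm{av}_{i\to z}(\rho).$$
   Context: Graph and Laplacian. $G=(V,E)$ is a finite directed graph, multiple edges permitted, connected and Eulerian: each vertex $i$ has the same number $\deg(i)$ of incoming edges as outgoing edges. For $u:V\to\mathbb{Z}$, $\Delta u(i)=-\deg(i)u(i)+\sum_e u(e^-)$, the sum being over edges $e$ coming into $i$, with $e^-$ the other endpoint (tail) of $e$. $\delta_i(j)=\mathbf{1}\{i=j\}$. Sandpiles. A sandpile is a function $s:V\to\mathbb{Z}$ (negative values allowed); $|s|=\sum_{i\in V}s(i)$. Vertex $i$ is unstable if $s(i)\ge\deg(i)$; toppling an unstable vertex $i$ replaces $s$ by $s+\Delta\delta_i$. $s$ is stabilizable if some finite (possibly empty) sequence of topplings of unstable vertices leads to a sandpile $\mathcal{S}(s)\le\deg-1$ (coordinatewise); $\mathcal{S}(s)$ does not depend on the sequence chosen. Closed chain. For $i\in V$, $a_i s=\mathcal{S}(s+\delta_i)$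 if $s+\delta_i$ is stabilizable, and $a_i s=s+\delta_i$ otherwise. Let $i_1,i_2,\ldots$ be independent random vertices with law $\alpha$. The closed chain started from a sandpile $s_0$ is $s_k=a_{i_k}s_{k-1}$ for $k\ge1$. $\mathbb{P}_{s_0}$ is the law of the process with initial state $s_0$. Sink and recurrent sandpiles. For a vertex $z$ (the sink), $\mathcal{S}_z$ denotes stabilization in which $z$ is forbidden to topple: unstable vertices other than $z$ are toppled until no vertex of $V-\{z\}$ is unstable (this always terminates), and chips entering $z$ disappear. A sandpile $\rho$ is $z$-recurrent if $\rho(z)=\deg(z)$, $\rho(i)\le\deg(i)-1$ for all $i\ne z$, and every vertex of $V-\{z\}$ topples exactly once during the stabilization of $\rho+\Delta\delta_z$ with respect to $\mathcal{S}_z$. $\mathrm{Rec}(z)$ is the set of $z$-recurrent sandpiles; its cardinality $\kappa$ does not depend on $z$. Open addition operators. $\hat a_i\rho=\mathcal{S}_z(\rho+\delta_i)$, where the value at $z$ is kept equal to $\deg(z)$ (chips reaching $z$ are discarded; in particular $\hat a_z\rho=\rho$). Each $\hat a_i$ acts as a permutation of $\mathrm{Rec}(z)$, and $\hat a_i^{-1}$ denotes the inverse of this permutation. Burst size. For $\rho\in\mathrm{Rec}(z)$ and $i\in V$, $\mathrm{av}_{i\to z}(\rho):=|\hat a_i^{-1}\rho|-|\rho|+1$. Recurrent representative. Every sandpile $s$ can be written in exactly one way as $s=\rho+m\delta_z+\Delta v$ with $\rho\in\mathrm{Rec}(z)$, $m\in\mathbb{Z}$, $v:V\to\mathbb{Z}$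 and $v(z)=0$; $R_z(s)$ denotes this $\rho$. Limit. "$F(s_0)\to L$ as $|s_0|\to-\infty$" means: for every $\epsilon>0$ there is $K<0$ such that $|F(s_0)-L|\le\epsilon$ for every $s_0:V\to\mathbb{Z}$ with $|s_0|<K$. *)

theory Defs
  imports "HOL-Probability.Probability" "Graph_Theory.Graph_Theory"
begin

text \<open>
  Graphs are multidigraphs \<open>G\<close> (loops allowed) whose vertex set is the whole
  finite type \<open>'v\<close>, so that functions on the vertex set are functions on \<open>'v\<close>.
  The degree is read off as the in-degree, which for Eulerian \<open>G\<close> is also the out-degree.
\<close>

type_synonym 'v sandpile = "'v \<Rightarrow> int"

definition deg :: "('v, 'e) pre_digraph \<Rightarrow> 'v \<Rightarrow> int" where
  "deg G i = int (in_degree G i)"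

definition laplacian :: "('v, 'e) pre_digraph \<Rightarrow> ('v \<Rightarrow> int) \<Rightarrow> ('v \<Rightarrow> int)" where
  "laplacian G u = (\<lambda>i. - deg G i * u i + (\<Sum>e\<in>in_arcs G i. u (tail G e)))"

definition delta :: "'v \<Rightarrow> 'v \<Rightarrow> int" where
  "delta i = (\<lambda>j. if i = j then 1 else 0)"

definition num_chips :: "'v::finite sandpile \<Rightarrow> int" where
  "num_chips s = (\<Sum>i\<in>UNIV. s i)"

definition unstable :: "('v, 'e) pre_digraph \<Rightarrow> 'v sandpile \<Rightarrow> 'v \<Rightarrow> bool" where
  "unstable G s i \<longleftrightarrow> s i \<ge> deg G i"

text \<open>
  Toppling relative to a set \<open>Z\<close> of sinks: sinks never topple and chips sent to a sink
  disappear. The closed case is \<open>Z = {}\<close>, the case of one sink \<open>z\<close> is \<open>Z = {z}\<close>.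
\<close>

definition topple :: "('v, 'e) pre_digraph \<Rightarrow> 'v set \<Rightarrow> 'v \<Rightarrow> 'v sandpile \<Rightarrow> 'v sandpile" where
  "topple G Z i s = (\<lambda>j. if j \<in> Z then s j else s j + laplacian G (delta i) j)"

fun legal :: "('v, 'e) pre_digraph \<Rightarrow> 'v set \<Rightarrow> 'v sandpile \<Rightarrow> 'v list \<Rightarrow> bool" where
  "legal G Z s [] \<longleftrightarrow> True"
| "legal G Z s (i # is) \<longleftrightarrow> i \<notin> Z \<and> unstable G s i \<and> legal G Z (topple G Z i s) is"

definition stabilizing :: "('v, 'e) pre_digraph \<Rightarrow> 'v set \<Rightarrow> 'v sandpile \<Rightarrow> 'v list \<Rightarrow> bool" where
  "stabilizing G Z s is \<longleftrightarrow>
     legal G Z s is \<and> (\<forall>i. i \<notin> Z \<longrightarrow> \<not> unstable G (fold (topple G Z) is s) i)"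

definition stabilizable :: "('v, 'e) pre_digraph \<Rightarrow> 'v set \<Rightarrow> 'v sandpile \<Rightarrow> bool" where
  "stabilizable G Z s \<longleftrightarrow> (\<exists>is. stabilizing G Z s is)"

definition stabilization :: "('v, 'e) pre_digraph \<Rightarrow> 'v set \<Rightarrow> 'v sandpile \<Rightarrow> 'v sandpile" where
  "stabilization G Z s = (THE t. \<exists>is. stabilizing G Z s is \<and> t = fold (topple G Z) is s)"

definition add_op :: "('v, 'e) pre_digraph \<Rightarrow> 'v \<Rightarrow> 'v sandpile \<Rightarrow> 'v sandpile" where
  "add_op G i s = (let s' = (\<lambda>j. s j + delta i j)
                   in if stabilizable G {} s' then stabilization G {} s' else s')"

text \<open>The driving sequence is indexed from \<open>0\<close>: \<open>x k\<close> is the vertex used in step \<open>k + 1\<close>.\<close>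

primrec chain :: "('v, 'e) pre_digraph \<Rightarrow> 'v sandpile \<Rightarrow> (nat \<Rightarrow> 'v) \<Rightarrow> nat \<Rightarrow> 'v sandpile" where
  "chain G s0 x 0 = s0"
| "chain G s0 x (Suc k) = add_op G (x k) (chain G s0 x k)"

text \<open>
  On a connected Eulerian graph the minimum always exists: as long as the chain is
  stabilizable, each step increases the number of chips by one, and after the first step
  that number is at most the sum of \<open>deg - 1\<close>.
\<close>

definition threshold_time :: "('v, 'e) pre_digraph \<Rightarrow> 'v sandpile \<Rightarrow> (nat \<Rightarrow> 'v) \<Rightarrow> nat" where
  "threshold_time G s0 x = (LEAST k. \<not> stabilizable G {} (chain G s0 x k))"

definition threshold_state ::
    "('v, 'e) pre_digraph \<Rightarrow> 'v sandpile \<Rightarrow> (nat \<Rightarrow> 'v) \<Rightarrow> 'v sandpile" where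
  "threshold_state G s0 x = chain G s0 x (threshold_time G s0 x)"

text \<open>
  Which vertices topple, and how often, does not depend on the stabilizing sequence, so
  that it suffices to ask for one such sequence.
\<close>

definition recurrent :: "('v, 'e) pre_digraph \<Rightarrow> 'v \<Rightarrow> 'v sandpile \<Rightarrow> bool" where
  "recurrent G z \<rho> \<longleftrightarrow>
     \<rho> z = deg G z \<and> (\<forall>i. i \<noteq> z \<longrightarrow> \<rho> i \<le> deg G i - 1) \<and>
     (\<exists>is. stabilizing G {z} (\<lambda>j. \<rho> j + laplacian G (delta z) j) is \<and>
           (\<forall>i. i \<noteq> z \<longrightarrow> count_list is i = 1))"

definition Rec :: "('v, 'e) pre_digraph \<Rightarrow> 'v \<Rightarrow> 'v sandpile set" where
  "Rec G z = {\<rho>. recurrent G z \<rho>}"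

definition open_add_op :: "('v, 'e) pre_digraph \<Rightarrow> 'v \<Rightarrow> 'v \<Rightarrow> 'v sandpile \<Rightarrow> 'v sandpile" where
  "open_add_op G z i \<rho> = (stabilization G {z} (\<lambda>j. \<rho> j + delta i j))(z := deg G z)"

text \<open>The inverse is that of the permutation which \<open>open_add_op G z i\<close> induces on \<open>Rec G z\<close>.\<close>

definition burst_size ::
    "('v::finite, 'e) pre_digraph \<Rightarrow> 'v \<Rightarrow> 'v \<Rightarrow> 'v sandpile \<Rightarrow> int" where
  "burst_size G z i \<rho> = num_chips (inv_into (Rec G z) (open_add_op G z i) \<rho>) - num_chips \<rho> + 1"

definition rec_rep :: "('v, 'e) pre_digraph \<Rightarrow> 'v \<Rightarrow> 'v sandpile \<Rightarrow> 'v sandpile" where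
  "rec_rep G z s = (THE \<rho>. \<rho> \<in> Rec G z \<and>
     (\<exists>(m::int) v. v z = 0 \<and> s = (\<lambda>j. \<rho> j + m * delta z j + laplacian G v j)))"

end

theory Submission
  imports Defs
begin

text \<open>
  Modulo the image of the Laplacian and multiples of \<open>\<delta>\<^sub>z\<close>, every sandpile is equivalent to exactly
  one \<open>z\<close>-recurrent sandpile, and toppling does not leave the equivalence class. Hence the
  representatives \<open>\<rho>\<^sub>k\<close> of the states \<open>s\<^sub>k\<close> of the closed chain perform a random walk on \<open>Rec(z)\<close>, each
  chosen vertex \<open>i\<close> acting by its open addition operator (\<open>rec_rep_chain\<close>).
  This walk together with the number of chips decides when the threshold is reached. Write
  \<open>s = \<rho> + m \<delta>\<^sub>z + \<Delta>v\<close>. If \<open>m < 0\<close>, then \<open>\<rho> + m \<delta>\<^sub>z\<close> is stable, and by the least action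
  principle \<open>s\<close> is stabilizable; if \<open>m \<ge> 0\<close>, the burning criterion for \<open>\<rho>\<close> shows that no sandpile
  \<open>s + \<Delta>w\<close> is stable. Since \<open>G\<close> is Eulerian, \<open>\<Delta>v\<close> has sum zero and \<open>m = |s| - |\<rho>|\<close>, so that \<open>s\<close> is
  stabilizable if and only if \<open>|s| < |\<rho>|\<close> (\<open>stabilizable_iff_num_chips\<close>).

  Along the chain \<open>m\<^sub>k = |s\<^sub>0| + k - |\<rho>\<^sub>k|\<close> never decreases, because open addition adds one chip
  and may only lose chips. So the chain reaches its threshold at time \<open>k + 1\<close>, in the class of
  \<open>\<rho>\<close> and by the addition of a chip at \<open>i\<close>, if and only if \<open>\<rho>\<^sub>k\<close> is the preimage \<open>\<sigma>\<close> of \<open>\<rho>\<close> under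
  the operator of \<open>i\<close> and \<open>|\<rho>| \<le> |s\<^sub>0| + k + 1 \<le> |\<sigma>|\<close>. The last condition holds for exactly
  \<open>|\<sigma>| - |\<rho>| + 1\<close> values of \<open>k\<close>, and this number is the burst size (\<open>threshold_at_Suc_iff\<close>,
  \<open>card_threshold_window\<close>). These events are disjoint, and each has probability
  \<open>\<alpha>\<^sub>i P(\<rho>\<^sub>k = \<sigma>)\<close> because \<open>\<rho>\<^sub>k\<close> depends only on the vertices chosen before.

  As \<open>|s\<^sub>0|\<close> tends to \<open>-\<infinity>\<close>, all these \<open>k\<close> tend to infinity. The walk is driven by permutations, so the
  uniform distribution is stationary; it is irreducible; and it is aperiodic, since adding a
  chip at the sink \<open>z\<close>, which has positive probability, leaves a recurrent sandpile unchanged. So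
  \<open>P(\<rho>\<^sub>k = \<sigma>)\<close> tends to \<open>1/\<kappa>\<close> for each of the finitely many starting points
  (\<open>step_converges_to_average\<close>), and adding up gives the limit.
\<close>

section \<open>Random walks driven by permutations\<close>

primrec driven_orbit :: "('i \<Rightarrow> 's \<Rightarrow> 's) \<Rightarrow> 's \<Rightarrow> (nat \<Rightarrow> 'i) \<Rightarrow> nat \<Rightarrow> 's" where
  "driven_orbit T y x 0 = y"
| "driven_orbit T y x (Suc k) = T (x k) (driven_orbit T y x k)"

text \<open>
  The letter \<open>e\<close>, which acts as the identity, makes the walk aperiodic.
\<close>

locale permutation_walk =
  fixes S :: "'s set" and T :: "'i::finite \<Rightarrow> 's \<Rightarrow> 's" and a :: "'i \<Rightarrow> real" and e :: 'i
  assumes finite: "finite S"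
    and bij: "\<And>i. bij_betw (T i) S S"
    and pos: "\<And>i. a i > 0" and sum_a: "(\<Sum>i\<in>UNIV. a i) = 1"
    and lazy: "\<And>s. s \<in> S \<Longrightarrow> T e s = s"
    and irreducible: "\<And>s t. s \<in> S \<Longrightarrow> t \<in> S \<Longrightarrow> (s, t) \<in> {(s, T i s) | s i. s \<in> S}\<^sup>*"
begin

abbreviation inv_T :: "'i \<Rightarrow> 's \<Rightarrow> 's" where
  "inv_T i \<equiv> inv_into S (T i)"

text \<open>
  If \<open>f\<close> is the law of the position of the walk, then \<open>step f\<close> is its law one step later.
  Equally, \<open>step f s\<close> is the mean of \<open>f\<close> after one step from \<open>s\<close> of the walk driven by the inverse
  permutations.
\<close>

definition step :: "('s \<Rightarrow> real) \<Rightarrow> 's \<Rightarrow> real" where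
  "step f s = (\<Sum>i\<in>UNIV. a i * f (inv_T i s))"

lemma T_in: "s \<in> S \<Longrightarrow> T i s \<in> S"
  using bij bij_betw_apply by metis

lemma inv_T_in: "s \<in> S \<Longrightarrow> inv_T i s \<in> S"
  using bij_betw_inv_into[OF bij] bij_betw_apply by metis

lemma T_eq_iff: "s \<in> S \<Longrightarrow> t \<in> S \<Longrightarrow> T i s = t \<longleftrightarrow> s = inv_T i t"
  using bij[of i] by (metis bij_betw_inv_into_left bij_betw_inv_into_right)

lemma a_nonneg: "0 \<le> a i"
  using pos[of i] by simp

lemma step_add: "(step ^^ n) (\<lambda>s. f s + g s) = (\<lambda>s. (step ^^ n) f s + (step ^^ n) g s)"
  by (induction n) (auto simp: step_def algebra_simps sum.distrib)

lemma step_scale: "(step ^^ n) (\<lambda>s. c * f s) = (\<lambda>s. c * (step ^^ n) f s)"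
  by (induction n) (auto simp: step_def sum_distrib_left algebra_simps)

lemma step_const: "(step ^^ n) (\<lambda>s. c) = (\<lambda>s. c)"
  by (induction n) (auto simp: step_def sum_a simp flip: sum_distrib_right)

lemma step_nonneg:
  assumes "\<And>t. t \<in> S \<Longrightarrow> 0 \<le> f t" "s \<in> S"
  shows "0 \<le> (step ^^ n) f s"
  using assms(2) by (induction n arbitrary: s)
    (auto simp: step_def assms(1) a_nonneg inv_T_in intro!: sum_nonneg mult_nonneg_nonneg)

lemma step_ge_summand:
  assumes "\<And>t. t \<in> S \<Longrightarrow> 0 \<le> f t" "s \<in> S"
  shows "a i * f (inv_T i s) \<le> step f s"
  unfolding step_def
  using member_le_sum[of i UNIV "\<lambda>i. a i * f (inv_T i s)"] assms
  by (auto simp: a_nonneg inv_T_in)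

lemma step_lazy:
  assumes "\<And>t. t \<in> S \<Longrightarrow> 0 \<le> f t" "s \<in> S"
  shows "a e ^ n * f s \<le> (step ^^ n) f s"
proof (induction n)
  case (Suc n)
  have "inv_T e s = s"
    using T_eq_iff[of s s e] lazy assms by auto
  have "a e ^ Suc n * f s \<le> a e * (step ^^ n) f s"
    using mult_left_mono[OF Suc a_nonneg[of e]] by (simp add: algebra_simps)
  also have "\<dots> \<le> (step ^^ Suc n) f s"
    using step_ge_summand[of "(step ^^ n) f" s e] step_nonneg assms \<open>inv_T e s = s\<close> by simp
  finally show ?case .
qed simp

lemma sum_step: "(\<Sum>s\<in>S. (step ^^ n) f s) = (\<Sum>s\<in>S. f s)"
proof (induction n)
  case (Suc n)
  have "(\<Sum>s\<in>S. (step ^^ Suc n) f s) = (\<Sum>i\<in>UNIV. a i * (\<Sum>s\<in>S. (step ^^ n) f (inv_T i s)))"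
    by (simp add: step_def sum_distrib_left) (rule sum.swap)
  also have "\<dots> = (\<Sum>i\<in>UNIV. a i * (\<Sum>s\<in>S. (step ^^ n) f s))"
    by (intro sum.cong refl arg_cong2[where f = "(*)"] sum.reindex_bij_betw bij_betw_inv_into bij)
  finally show ?case
    by (simp add: Suc sum_a flip: sum_distrib_right)
qed simp

text \<open>
  A path from \<open>t\<close> to \<open>s\<close> carries mass from \<open>t\<close> to \<open>s\<close>, at the cost of one positive factor \<open>a i\<close> for
  each letter.
\<close>

lemma step_minorized_at:
  assumes "s \<in> S" "t \<in> S"
  shows "\<exists>n. \<exists>c>0. \<forall>f. (\<forall>u\<in>S. 0 \<le> f u) \<longrightarrow> c * f t \<le> (step ^^ n) f s"
proof -
  have "(t, s) \<in> {(s, T i s) | s i. s \<in> S}\<^sup>*"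
    using irreducible assms by blast
  then show ?thesis
    using assms(2)
  proof (induction rule: converse_rtrancl_induct)
    case base
    show ?case
      by (intro exI[of _ 0] exI[of _ 1]) auto
  next
    case (step t u)
    then obtain i where i: "u = T i t"
      by auto
    obtain n c where c: "c > 0" "\<And>f. (\<forall>u\<in>S. 0 \<le> f u) \<Longrightarrow> c * f u \<le> (step ^^ n) f s"
      using step.IH T_in[of t i] step.prems i by blast
    have "c * a i * f t \<le> (step ^^ Suc n) f s" if f: "\<forall>u\<in>S. 0 \<le> f u" for f
    proof -
      have "inv_T i u = t"
        using i T_eq_iff[of t u i] T_in[of t i] step.prems by auto
      then have "c * (a i * f t) \<le> c * step f u"
        using step_ge_summand[of f u i] f i T_in[of t i] step.prems c by (intro mult_left_mono) auto
      also have "\<dots> \<le> (step ^^ n) (step f) s"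
        using step_nonneg[of f _ 1] f by (intro c(2)) auto
      finally show ?thesis
        by (simp add: funpow_swap1 mult.assoc)
    qed
    then show ?case
      using c pos[of i] by (intro exI[of _ "Suc n"] exI[of _ "c * a i"]) auto
  qed
qed

text \<open>
  The Doeblin condition: idling with the letter \<open>e\<close> gives all the connecting paths the same
  length, and by finiteness there is a smallest constant.
\<close>

lemma step_minorized:
  "\<exists>N>0. \<exists>c>0. c \<le> 1 \<and> (\<forall>f. \<forall>s\<in>S. \<forall>t\<in>S. (\<forall>u\<in>S. 0 \<le> f u) \<longrightarrow> c * f t \<le> (step ^^ N) f s)"
proof -
  have "\<forall>p\<in>S \<times> S. \<exists>n. \<exists>c>0. \<forall>f. (\<forall>u\<in>S. 0 \<le> f u) \<longrightarrow> c * f (snd p) \<le> (step ^^ n) f (fst p)"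
    using step_minorized_at by auto
  then obtain n where "\<forall>p\<in>S \<times> S. \<exists>c>0. \<forall>f. (\<forall>u\<in>S. 0 \<le> f u) \<longrightarrow> c * f (snd p) \<le> (step ^^ n p) f (fst p)"
    by metis
  then obtain d where d: "\<And>p. p \<in> S \<times> S \<Longrightarrow> d p > 0"
    "\<And>p f. p \<in> S \<times> S \<Longrightarrow> (\<forall>u\<in>S. 0 \<le> f u) \<Longrightarrow> d p * f (snd p) \<le> (step ^^ n p) f (fst p)"
    by metis
  obtain N where N: "\<And>p. p \<in> S \<times> S \<Longrightarrow> n p < N" "N > 0"
    using finite finite_nat_set_iff_bounded[of "insert 0 (n ` (S \<times> S))"] by auto
  \<comment> \<open>\<open>N - n p\<close> idle steps, each of probability \<open>a e\<close>, after the \<open>n p\<close> steps of the path.\<close>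
  define b where "b p = a e ^ (N - n p) * d p" for p
  define c where "c = Min (insert 1 (b ` (S \<times> S)))"
  have b_pos: "b p > 0" if "p \<in> S \<times> S" for p
    using d(1)[OF that] pos by (simp add: b_def)
  have "c * f t \<le> (step ^^ N) f s" if st: "s \<in> S" "t \<in> S" and f: "\<And>u. u \<in> S \<Longrightarrow> 0 \<le> f u" for f s t
  proof -
    have p: "(s, t) \<in> S \<times> S"
      using st by simp
    have "c \<le> b (s, t)"
      unfolding c_def using finite p by (intro Min_le) auto
    then have "c * f t \<le> b (s, t) * f t"
      using f st by (intro mult_right_mono) auto
    also have "\<dots> \<le> a e ^ (N - n (s, t)) * (step ^^ n (s, t)) f s"
      unfolding b_def mult.assoc using d(2)[OF p, of f] f by (intro mult_left_mono) (auto simp: a_nonneg)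
    also have "\<dots> \<le> (step ^^ (N - n (s, t))) ((step ^^ n (s, t)) f) s"
      using st f by (intro step_lazy step_nonneg) auto
    also have "\<dots> = (step ^^ N) f s"
      using N(1)[OF p] by (simp flip: comp_apply[of "step ^^ _" "step ^^ _"] funpow_add)
    finally show ?thesis .
  qed
  note minor = this
  have "c > 0" "c \<le> 1"
    unfolding c_def using finite b_pos by (auto intro!: Min_le)
  then show ?thesis
    by (intro exI[of _ N] exI[of _ c] conjI allI ballI impI minor N(2)) auto
qed

text \<open>
  If \<open>f\<close> has sum zero and is bounded by \<open>B\<close>, then \<open>B - f\<close> and \<open>B + f\<close> are nonnegative with
  average \<open>B\<close>. Averaging the minorization over its point \<open>t\<close> therefore leaves at least \<open>c B\<close> in
  either function, which keeps \<open>f\<close> at distance \<open>c B\<close> from both bounds.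
\<close>

lemma step_contraction:
  "\<exists>N>0. \<exists>r\<ge>0. r < 1 \<and> (\<forall>f B. (\<Sum>s\<in>S. f s) = 0 \<longrightarrow> (\<forall>s\<in>S. \<bar>f s\<bar> \<le> B) \<longrightarrow>
    (\<forall>s\<in>S. \<bar>(step ^^ N) f s\<bar> \<le> r * B))"
proof -
  obtain N c where N: "N > 0" and c: "0 < c" "c \<le> 1"
    and minor: "\<forall>f. \<forall>s\<in>S. \<forall>t\<in>S. (\<forall>u\<in>S. 0 \<le> f u) \<longrightarrow> c * f t \<le> (step ^^ N) f s"
    using step_minorized by (elim exE conjE)
  have upper: "(step ^^ N) f s \<le> (1 - c) * B"
    if sum: "(\<Sum>s\<in>S. f s) = 0" and B: "\<And>s. s \<in> S \<Longrightarrow> f s \<le> B" and s: "s \<in> S" for f B s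
  proof -
    define g where "g = (\<lambda>s. B + (-1) * f s)"
    have "real (card S) * (c * B) = c * (\<Sum>t\<in>S. g t)"
      by (simp add: g_def sum_subtractf sum)
    also have "\<dots> = (\<Sum>t\<in>S. c * g t)"
      by (simp add: sum_distrib_left)
    also have "\<dots> \<le> (\<Sum>t\<in>S. (step ^^ N) g s)"
      by (intro sum_mono minor[rule_format]) (use s B in \<open>auto simp: g_def\<close>)
    also have "\<dots> = real (card S) * (B - (step ^^ N) f s)"
      unfolding g_def step_add step_scale step_const by simp
    finally have "c * B \<le> B - (step ^^ N) f s"
      using s finite card_gt_0_iff[of S] by (auto simp: mult_le_cancel_left)
    then show ?thesis
      by (simp add: algebra_simps)
  qed
  have both: "\<bar>(step ^^ N) f s\<bar> \<le> (1 - c) * B"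
    if sum: "(\<Sum>s\<in>S. f s) = 0" and B: "\<And>s. s \<in> S \<Longrightarrow> \<bar>f s\<bar> \<le> B" and s: "s \<in> S" for f B s
  proof -
    have "(step ^^ N) f s \<le> (1 - c) * B"
      by (rule upper) (use sum B s abs_le_D1 in auto)
    moreover have "(step ^^ N) (\<lambda>s. (-1) * f s) s \<le> (1 - c) * B"
      by (rule upper) (use sum B s abs_le_D2 in \<open>auto simp: sum_negf\<close>)
    ultimately show ?thesis
      unfolding step_scale by simp
  qed
  show ?thesis
  proof (intro exI[of _ N] conjI exI[of _ "1 - c"] allI impI ballI)
    fix f :: "'s \<Rightarrow> real" and B s
    assume "(\<Sum>s\<in>S. f s) = 0" "\<forall>s\<in>S. \<bar>f s\<bar> \<le> B" "s \<in> S"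
    then show "\<bar>(step ^^ N) f s\<bar> \<le> (1 - c) * B"
      by (intro both) auto
  qed (use N c in auto)
qed

text \<open>
  Bijectivity makes \<open>step\<close> preserve sums, so the difference from the average keeps sum zero and
  decays geometrically along multiples of the \<open>N\<close> of the contraction; in between it cannot grow.
\<close>

theorem step_converges_to_average:
  assumes "s \<in> S"
  shows "(\<lambda>n. (step ^^ n) f s) \<longlonglongrightarrow> (\<Sum>t\<in>S. f t) / real (card S)"
proof -
  define m where "m = (\<Sum>t\<in>S. f t) / real (card S)"
  define g where "g = (\<lambda>t. f t + - m)"
  have "card S > 0"
    using assms finite by (auto simp: card_gt_0_iff)
  then have sum_g: "(\<Sum>t\<in>S. (step ^^ n) g t) = 0" for n
    unfolding sum_step by (simp add: g_def m_def sum_subtractf)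
  define B where "B = (\<Sum>t\<in>S. \<bar>g t\<bar>)"
  have B: "\<bar>g t\<bar> \<le> B" if "t \<in> S" for t
    unfolding B_def using that finite by (intro member_le_sum) auto
  obtain N r where N: "N > 0" and r: "0 \<le> r" "r < 1"
    and contract: "\<forall>f B. (\<Sum>s\<in>S. f s) = 0 \<longrightarrow> (\<forall>s\<in>S. \<bar>f s\<bar> \<le> B) \<longrightarrow>
      (\<forall>s\<in>S. \<bar>(step ^^ N) f s\<bar> \<le> r * B)"
    using step_contraction by (elim exE conjE)
  have bound: "\<bar>(step ^^ n) g t\<bar> \<le> B" if "t \<in> S" for n t
    using that
  proof (induction n arbitrary: t)
    case (Suc n)
    have "\<bar>(step ^^ Suc n) g t\<bar> \<le> (\<Sum>i\<in>UNIV. \<bar>a i * (step ^^ n) g (inv_T i t)\<bar>)"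
      unfolding funpow.simps comp_apply step_def by (rule sum_abs)
    also have "\<dots> \<le> (\<Sum>i\<in>UNIV. a i * B)"
      using Suc inv_T_in by (intro sum_mono) (auto simp: abs_mult a_nonneg intro!: mult_left_mono)
    finally show ?case
      by (simp add: sum_a flip: sum_distrib_right)
  qed (simp add: B)
  have geom: "\<bar>(step ^^ (k * N + j)) g t\<bar> \<le> r ^ k * B" if "t \<in> S" for k j t
    using that
  proof (induction k arbitrary: t)
    case (Suc k)
    have "(step ^^ (Suc k * N + j)) g t = (step ^^ N) ((step ^^ (k * N + j)) g) t"
      by (simp flip: comp_apply[of "step ^^ _" "step ^^ _"] funpow_add add: add.assoc)
    then show ?case
      using contract[rule_format, OF sum_g[of "k * N + j"], of "r ^ k * B" t] Suc by (simp add: mult.assoc)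
  qed (simp add: bound)
  have "(\<lambda>n. (step ^^ n) g s) \<longlonglongrightarrow> 0"
  proof (rule Lim_null_comparison)
    have "norm ((step ^^ n) g s) \<le> r ^ (n div N) * B" for n
      using geom[OF assms, of "n div N" "n mod N"] by simp
    then show "\<forall>\<^sub>F n in sequentially. norm ((step ^^ n) g s) \<le> r ^ (n div N) * B"
      by (intro always_eventually allI)
    have "filterlim (\<lambda>n. n div N) sequentially sequentially"
      using N by (simp add: filterlim_at_top_div_const_nat)
    then have "(\<lambda>n. r ^ (n div N)) \<longlonglongrightarrow> 0"
      by (rule filterlim_compose[OF LIMSEQ_power_zero, rotated]) (use r in simp)
    then show "(\<lambda>n. r ^ (n div N) * B) \<longlonglongrightarrow> 0"
      by (rule tendsto_mult_left_zero)
  qed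
  moreover have "(step ^^ n) g s = (step ^^ n) f s - m" for n
    unfolding g_def step_add step_const by simp
  ultimately show ?thesis
    unfolding m_def[symmetric] by (simp add: LIM_zero_iff)
qed

lemma driven_orbit_in: "y \<in> S \<Longrightarrow> driven_orbit T y x k \<in> S"
  by (induction k) (auto simp: T_in)

text \<open>
  Prescribing finitely many letters that have not been used yet is what the induction on \<open>k\<close>
  needs: the last letter of a longer orbit is such a letter for the shorter one. For \<open>J = {k}\<close>
  the formula says that the position after \<open>k\<close> steps is independent of the next letter.
\<close>

lemma prob_driven_orbit:
  assumes "prob_space M"
    and indep: "prob_space.indep_vars M (\<lambda>_. count_space UNIV) X UNIV"
    and law: "\<And>k i. measure M (X k -` {i} \<inter> space M) = a i"
    and "y \<in> S" "s \<in> S" "finite J" "J \<subseteq> {k..}"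
  shows "{\<omega> \<in> space M. driven_orbit T y (\<lambda>k. X k \<omega>) k = s \<and> (\<forall>j\<in>J. X j \<omega> = f j)} \<in> sets M \<and>
    measure M {\<omega> \<in> space M. driven_orbit T y (\<lambda>k. X k \<omega>) k = s \<and> (\<forall>j\<in>J. X j \<omega> = f j)}
      = (step ^^ k) (indicator {y}) s * (\<Prod>j\<in>J. a (f j))"
  (is "?E k s J f \<in> _ \<and> _")
proof -
  interpret prob_space M by fact
  have rv: "X j \<in> measurable M (count_space UNIV)" for j
    using indep by (auto simp: indep_vars_def)
  show ?thesis
    using assms(5-)
  proof (induction k arbitrary: s J f)
    case 0
    have ev: "{\<omega> \<in> space M. \<forall>j\<in>J. X j \<omega> = f j} \<in> events"
      using rv \<open>finite J\<close> by measurable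
    have "prob {\<omega> \<in> space M. \<forall>j\<in>J. X j \<omega> = f j} = (\<Prod>j\<in>J. a (f j))"
    proof (cases "J = {}")
      case False
      then have "{\<omega> \<in> space M. \<forall>j\<in>J. X j \<omega> = f j} = (\<Inter>j\<in>J. X j -` {f j} \<inter> space M)"
        by auto
      then show ?thesis
        using indep_varsD[OF indep False \<open>finite J\<close>, of "\<lambda>j. {f j}"] by (simp add: law)
    qed (simp add: prob_space)
    then show ?case
      using ev by (cases "y = s") auto
  next
    case (Suc k)
    define A where "A i = ?E k (inv_T i s) (insert k J) (f(k := i))" for i
    have kJ: "k \<notin> J"
      using Suc.prems by auto
    have A: "A i \<in> events \<and> prob (A i) = (step ^^ k) (indicator {y}) (inv_T i s) * (a i * (\<Prod>j\<in>J. a (f j)))" for i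
    proof -
      have "(\<Prod>j\<in>insert k J. a ((f(k := i)) j)) = a i * (\<Prod>j\<in>J. a ((f(k := i)) j))"
        using Suc.prems kJ by simp
      also have "(\<Prod>j\<in>J. a ((f(k := i)) j)) = (\<Prod>j\<in>J. a (f j))"
        using kJ by (intro prod.cong) auto
      finally have prod: "(\<Prod>j\<in>insert k J. a ((f(k := i)) j)) = a i * (\<Prod>j\<in>J. a (f j))" .
      show ?thesis
        unfolding A_def prod[symmetric] by (rule Suc.IH) (use Suc.prems inv_T_in in auto)
    qed
    have E: "?E (Suc k) s J f = (\<Union>i\<in>UNIV. A i)"
      using kJ Suc.prems T_eq_iff[OF driven_orbit_in[OF \<open>y \<in> S\<close>]] by (auto simp: A_def)
    have "disjoint_family A"
      by (auto simp: disjoint_family_on_def A_def)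
    then have "prob (\<Union>i\<in>UNIV. A i) = (\<Sum>i\<in>UNIV. prob (A i))"
      by (intro finite_measure_finite_Union) (use A in auto)
    also have "\<dots> = (step ^^ Suc k) (indicator {y}) s * (\<Prod>j\<in>J. a (f j))"
      using A by (simp add: step_def sum_distrib_left mult_ac)
    finally show ?case
      using A unfolding E by auto
  qed
qed

end

section \<open>The Laplacian\<close>

definition arc_mult :: "('v, 'e) pre_digraph \<Rightarrow> 'v \<Rightarrow> 'v \<Rightarrow> int" where
  "arc_mult G i j = int (card {e \<in> arcs G. tail G e = i \<and> head G e = j})"

lemma arc_mult_nonneg [simp]: "0 \<le> arc_mult G i j"
  by (simp add: arc_mult_def)

locale eulerian_graph =
  fixes G :: "('v::finite, 'e) pre_digraph"
  assumes fin_digraph: "fin_digraph G"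
    and verts: "verts G = UNIV"
    and connected: "Digraph_Component.connected G"
    and eulerian: "\<And>i. in_degree G i = out_degree G i"
begin

lemma finite_arcs: "finite (arcs G)"
  using fin_digraph by (rule fin_digraph.finite_arcs)

lemma sum_in_arcs_tail:
  fixes f :: "'v \<Rightarrow> int"
  shows "(\<Sum>e\<in>in_arcs G j. f (tail G e)) = (\<Sum>i\<in>UNIV. arc_mult G i j * f i)"
proof -
  have "(\<Sum>e\<in>in_arcs G j. f (tail G e)) = (\<Sum>i\<in>UNIV. \<Sum>e\<in>{e \<in> in_arcs G j. tail G e = i}. f (tail G e))"
    by (rule sum.group[symmetric]) (auto simp: in_arcs_def finite_arcs)
  also have "\<dots> = (\<Sum>i\<in>UNIV. arc_mult G i j * f i)"
    by (intro sum.cong) (auto simp: arc_mult_def in_arcs_def intro!: arg_cong[where f = card])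
  finally show ?thesis .
qed

lemma sum_arc_mult_in: "(\<Sum>i\<in>UNIV. arc_mult G i j) = deg G j"
  using sum_in_arcs_tail[of "\<lambda>_. 1" j] by (simp add: deg_def in_degree_def)

lemma sum_arc_mult_out: "(\<Sum>j\<in>UNIV. arc_mult G i j) = deg G i"
proof -
  have "(\<Sum>j\<in>UNIV. arc_mult G i j) = (\<Sum>j\<in>UNIV. \<Sum>e\<in>{e \<in> out_arcs G i. head G e = j}. 1)"
    by (intro sum.cong) (auto simp: arc_mult_def out_arcs_def intro!: arg_cong[where f = card])
  also have "\<dots> = (\<Sum>e\<in>out_arcs G i. 1)"
    by (rule sum.group) (auto simp: out_arcs_def finite_arcs)
  also have "\<dots> = deg G i"
    by (simp add: deg_def eulerian out_degree_def)
  finally show ?thesis .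
qed

lemma deg_nonneg [simp]: "0 \<le> deg G i"
  by (simp add: deg_def)

text \<open>
  The form in which the Laplacian is used below: it shows that constants are in the
  kernel, and the sign of the Laplacian at an extremum.
\<close>

lemma laplacian_eq_sum_differences:
  "laplacian G u j = (\<Sum>i\<in>UNIV. arc_mult G i j * (u i - u j))"
  by (simp add: laplacian_def sum_in_arcs_tail right_diff_distrib sum_subtractf
      sum_arc_mult_in flip: sum_distrib_right)

lemma laplacian_add: "laplacian G (\<lambda>i. u i + v i) j = laplacian G u j + laplacian G v j"
  by (simp add: laplacian_eq_sum_differences algebra_simps sum.distrib sum_subtractf)

lemma laplacian_scale: "laplacian G (\<lambda>i. c * u i) j = c * laplacian G u j"
  by (simp add: laplacian_eq_sum_differences algebra_simps sum_distrib_left sum_subtractf)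

lemma laplacian_minus: "laplacian G (\<lambda>i. - u i) j = - laplacian G u j"
  using laplacian_scale[of "-1" u j] by simp

lemma laplacian_diff: "laplacian G (\<lambda>i. u i - v i) j = laplacian G u j - laplacian G v j"
  using laplacian_add[of u "\<lambda>i. - v i" j] by (simp add: laplacian_minus)

lemma laplacian_shift: "laplacian G (\<lambda>i. u i - c) = laplacian G u"
  by (simp add: laplacian_eq_sum_differences fun_eq_iff)

lemma laplacian_const [simp]: "laplacian G (\<lambda>i. c) j = 0"
  by (simp add: laplacian_eq_sum_differences)

lemma laplacian_delta: "laplacian G (delta i) j = arc_mult G i j - (if i = j then deg G j else 0)"
proof -
  have "(\<Sum>k\<in>UNIV. arc_mult G k j * delta i k) = (\<Sum>k\<in>UNIV. if k = i then arc_mult G i j else 0)"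
    by (intro sum.cong) (auto simp: delta_def)
  then show ?thesis
    by (simp add: laplacian_def sum_in_arcs_tail) (simp add: delta_def)
qed

lemma laplacian_nonneg_at_zero:
  assumes "\<And>i. u i \<ge> 0" and "u j = 0"
  shows "laplacian G u j \<ge> 0"
  using assms by (auto simp: laplacian_eq_sum_differences intro!: sum_nonneg)

lemma num_chips_laplacian: "num_chips (laplacian G u) = 0"
proof -
  have "num_chips (laplacian G u) = (\<Sum>j\<in>UNIV. \<Sum>i\<in>UNIV. arc_mult G i j * u i) - (\<Sum>j\<in>UNIV. deg G j * u j)"
    by (simp add: num_chips_def laplacian_def sum_in_arcs_tail sum_subtractf)
  also have "(\<Sum>j\<in>UNIV. \<Sum>i\<in>UNIV. arc_mult G i j * u i) = (\<Sum>i\<in>UNIV. (\<Sum>j\<in>UNIV. arc_mult G i j) * u i)"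
    by (subst sum.swap) (simp add: sum_distrib_right)
  finally show ?thesis
    by (simp add: sum_arc_mult_out)
qed

lemma num_chips_add_laplacian: "num_chips (\<lambda>j. s j + laplacian G u j) = num_chips s"
  using num_chips_laplacian[of u] by (simp add: num_chips_def sum.distrib)

lemma num_chips_add_delta: "num_chips (\<lambda>j. s j + c * delta i j) = num_chips s + c"
  by (simp add: num_chips_def sum.distrib delta_def flip: sum_distrib_left)

section \<open>Strong connectivity and a strictly superharmonic function\<close>

definition arc_rel :: "('v \<times> 'v) set" where
  "arc_rel = {(i, j). 0 < arc_mult G i j}"

lemma arc_relI: "e \<in> arcs G \<Longrightarrow> (tail G e, head G e) \<in> arc_rel"
  using finite_arcs by (auto simp: arc_rel_def arc_mult_def card_gt_0_iff)

text \<open>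
  If no arc leaves \<open>S\<close>, then no arc enters it: the numbers of arcs with tail in \<open>S\<close> and with head
  in \<open>S\<close> agree, and both include the arcs inside \<open>S\<close>. With this, weak connectivity implies
  strong connectivity.
\<close>

lemma closed_under_successors_imp_predecessors:
  assumes succ: "\<And>i j. (i, j) \<in> arc_rel \<Longrightarrow> i \<in> S \<Longrightarrow> j \<in> S"
    and arc: "(i, j) \<in> arc_rel" and "j \<in> S"
  shows "i \<in> S"
proof (rule ccontr)
  assume "i \<notin> S"
  have none: "arc_mult G k l = 0" if "k \<in> S" "l \<in> - S" for k l
  proof -
    have "\<not> 0 < arc_mult G k l"
      using succ[of k l] that by (auto simp: arc_rel_def)
    then show ?thesis
      using arc_mult_nonneg[of G k l] by linarith
  qed
  have split: "(\<Sum>k\<in>UNIV. f k) = (\<Sum>k\<in>S. f k) + (\<Sum>k\<in>-S. f k)" for f :: "'v \<Rightarrow> int"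
    using sum.subset_diff[of S UNIV f] by (simp add: Compl_eq_Diff_UNIV)
  have "(\<Sum>l\<in>S. deg G l) = (\<Sum>l\<in>S. \<Sum>k\<in>S. arc_mult G k l) + (\<Sum>l\<in>S. \<Sum>k\<in>-S. arc_mult G k l)"
    unfolding sum.distrib[symmetric]
    by (intro sum.cong refl) (simp only: sum_arc_mult_in split[symmetric])
  moreover have "(\<Sum>k\<in>S. deg G k) = (\<Sum>k\<in>S. \<Sum>l\<in>S. arc_mult G k l)"
    using none by (simp add: split flip: sum_arc_mult_out)
  moreover have "(\<Sum>l\<in>S. \<Sum>k\<in>S. arc_mult G k l) = (\<Sum>k\<in>S. \<Sum>l\<in>S. arc_mult G k l)"
    by (rule sum.swap)
  ultimately have "(\<Sum>l\<in>S. \<Sum>k\<in>-S. arc_mult G k l) = 0"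
    by simp
  then have "arc_mult G i j = 0"
    using \<open>j \<in> S\<close> \<open>i \<notin> S\<close> by (simp add: sum_nonneg_eq_0_iff sum_nonneg)
  then show False
    using arc by (simp add: arc_rel_def)
qed

lemma strongly_connected: "(i, j) \<in> arc_rel\<^sup>*"
proof -
  define S where "S = {j. (i, j) \<in> arc_rel\<^sup>*}"
  have succ: "\<And>k l. (k, l) \<in> arc_rel \<Longrightarrow> k \<in> S \<Longrightarrow> l \<in> S"
    by (auto simp: S_def)
  have pred: "k \<in> S" if "(k, l) \<in> arc_rel" "l \<in> S" for k l
    by (rule closed_under_successors_imp_predecessors[OF _ that]) (rule succ)
  have sym: "l \<in> S" if "(k, l) \<in> parcs (mk_symmetric G)" "k \<in> S" for k l
  proof -
    obtain e where e: "e \<in> arcs G"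
      "k = tail G e \<and> l = head G e \<or> k = head G e \<and> l = tail G e"
      using \<open>(k, l) \<in> _\<close> by (auto simp: parcs_mk_symmetric)
    then show ?thesis
      using succ[OF arc_relI[OF e(1)]] pred[OF arc_relI[OF e(1)]] \<open>k \<in> S\<close> by blast
  qed
  have "i \<rightarrow>\<^sup>*\<^bsub>mk_symmetric G\<^esub> j"
    using connected verts by (auto simp: Digraph_Component.connected_def strongly_connected_def)
  then have "(i, j) \<in> rtrancl_on (pverts (mk_symmetric G)) (parcs (mk_symmetric G))"
    by (simp add: reachable_def)
  then have "j \<in> S"
  proof (induction rule: rtrancl_on_induct)
    case base
    then show ?case by (simp add: S_def)
  next
    case (step k l)
    then show ?case using sym by blast
  qed
  then show ?thesis
    by (simp add: S_def)
qed

text \<open>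
  Take a function of the distance \<open>d\<close> from \<open>z\<close> that increases and is very concave, namely
  \<open>B\<^sup>n - B\<^sup>n\<^sup>-\<^sup>d\<close> with \<open>B\<close> larger than all degrees. Every \<open>i \<noteq> z\<close> has an in-neighbour closer to \<open>z\<close>,
  where the function is smaller by at least \<open>(B - 1) B\<^sup>n\<^sup>-\<^sup>d\<close>, while each in-neighbour exceeds
  the value at \<open>i\<close> by at most \<open>B\<^sup>n\<^sup>-\<^sup>d\<close>.

  Firing vertices as often as this function says removes at least one chip from every vertex other
  than \<open>z\<close>. This gives termination with a sink, and, run backwards, it makes a sandpile as large
  as required off the sink.
\<close>

lemma ex_strictly_superharmonic:
  "\<exists>h. (\<forall>i. h i \<ge> 0) \<and> h z = 0 \<and> (\<forall>i. i \<noteq> z \<longrightarrow> laplacian G h i \<le> -1)"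
proof -
  define d where "d i = (LEAST n. (z, i) \<in> arc_rel ^^ n)" for i
  have path: "(z, i) \<in> arc_rel ^^ d i" for i
    unfolding d_def by (rule LeastI_ex) (use strongly_connected[of z i] rtrancl_imp_relpow in blast)
  have d_le: "d j \<le> Suc (d i)" if "(i, j) \<in> arc_rel" for i j
    unfolding d_def[of j] by (rule Least_le) (use path[of i] that in auto)
  have dz: "d z = 0"
    by (simp add: d_def)
  obtain n where n: "d i \<le> n" for i
    using finite_nat_set_iff_bounded_le[of "range d"] by auto
  define B where "B = (\<Sum>i\<in>UNIV. deg G i) + 2"
  have B: "B \<ge> 2" "deg G i \<le> B - 2" for i
    by (auto simp: B_def intro!: sum_nonneg member_le_sum)
  have mono: "B ^ k \<le> B ^ l" if "k \<le> l" for k l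
    using B that by (intro power_increasing) auto
  define h where "h i = B ^ n - B ^ (n - d i)" for i
  have "laplacian G h i \<le> -1" if "i \<noteq> z" for i
  proof -
    obtain m where m: "d i = Suc m"
      using path[of i] \<open>i \<noteq> z\<close> by (cases "d i") auto
    then obtain p where p: "(z, p) \<in> arc_rel ^^ m" "(p, i) \<in> arc_rel"
      using path[of i] by auto
    have "d p \<le> m"
      unfolding d_def by (rule Least_le) (rule p)
    have "n - d i + 1 \<le> n - d p"
      using n[of i] m \<open>d p \<le> m\<close> by simp
    then have hp: "h p - h i \<le> B ^ (n - d i) - B * B ^ (n - d i)"
      using mono[of "n - d i + 1" "n - d p"] by (simp add: h_def)
    have "laplacian G h i = arc_mult G p i * (h p - h i) + (\<Sum>k\<in>-{p}. arc_mult G k i * (h k - h i))"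
      using sum.remove[of UNIV p "\<lambda>k. arc_mult G k i * (h k - h i)"]
      by (simp add: laplacian_eq_sum_differences Compl_eq_Diff_UNIV)
    also have "arc_mult G p i * (h p - h i) \<le> arc_mult G p i * B ^ (n - d i) - B * B ^ (n - d i)"
    proof -
      have "arc_mult G p i * (h p - h i) \<le> arc_mult G p i * (B ^ (n - d i) - B * B ^ (n - d i))"
        by (intro mult_left_mono hp) simp
      moreover have "1 * (B * B ^ (n - d i)) \<le> arc_mult G p i * (B * B ^ (n - d i))"
        using p(2) B by (intro mult_right_mono) (auto simp: arc_rel_def)
      ultimately show ?thesis by (simp add: right_diff_distrib)
    qed
    also have "(\<Sum>k\<in>-{p}. arc_mult G k i * (h k - h i)) \<le> (\<Sum>k\<in>-{p}. arc_mult G k i * B ^ (n - d i))"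
      using B by (intro sum_mono mult_left_mono) (auto simp: h_def)
    finally have "laplacian G h i \<le> (\<Sum>k\<in>UNIV. arc_mult G k i * B ^ (n - d i)) - B * B ^ (n - d i)"
      using sum.remove[of UNIV p "\<lambda>k. arc_mult G k i * B ^ (n - d i)"]
      by (simp add: Compl_eq_Diff_UNIV)
    also have "\<dots> = (deg G i - B) * B ^ (n - d i)"
      by (simp add: left_diff_distrib sum_arc_mult_in flip: sum_distrib_right)
    also have "\<dots> \<le> (-1) * B ^ (n - d i)"
      using B by (intro mult_right_mono) (auto simp: algebra_simps, smt (verit))
    also have "\<dots> \<le> -1"
      using B by simp
    finally show ?thesis .
  qed
  moreover have "h i \<ge> 0" for i
    using mono[of "n - d i" n] by (simp add: h_def)
  moreover have "h z = 0"
    by (simp add: h_def dz)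
  ultimately show ?thesis by blast
qed

section \<open>Least action and abelianness\<close>

lemma fold_topple:
  "fold (topple G Z) is s =
    (\<lambda>j. if j \<in> Z then s j else s j + laplacian G (\<lambda>i. int (count_list is i)) j)"
proof (induction "is" arbitrary: s)
  case (Cons i "is")
  have "(\<lambda>k. int (count_list (i # is) k)) = (\<lambda>k. delta i k + int (count_list is k))"
    by (auto simp: delta_def fun_eq_iff)
  then show ?case
    by (simp add: Cons.IH) (auto simp: topple_def laplacian_add fun_eq_iff)
qed (auto simp: fun_eq_iff)

lemma legal_append:
  "legal G Z s (is @ js) \<longleftrightarrow> legal G Z s is \<and> legal G Z (fold (topple G Z) is s) js"
  by (induction "is" arbitrary: s) auto

lemma legal_sinks_unused: "legal G Z s is \<Longrightarrow> i \<in> set is \<Longrightarrow> i \<notin> Z"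
  by (induction "is" arbitrary: s) auto

lemma stabilizing_iff:
  "stabilizing G Z s is \<longleftrightarrow> legal G Z s is \<and>
    (\<forall>i. i \<notin> Z \<longrightarrow> s i + laplacian G (\<lambda>i. int (count_list is i)) i < deg G i)"
  by (auto simp: stabilizing_def fold_topple unstable_def not_le)

text \<open>
  A vertex \<open>k\<close> that is unstable in \<open>s\<close> must be fired by every \<open>w\<close> that leads to stability, since
  otherwise it could only gain chips. So the first toppling of a legal sequence can be taken
  from \<open>w\<close>, and the rest follows by induction.
\<close>

lemma least_action:
  assumes "legal G Z s is" and "\<And>i. w i \<ge> 0"
    and "\<And>j. j \<notin> Z \<Longrightarrow> s j + laplacian G w j < deg G j"
  shows "int (count_list is i) \<le> w i"
  using assms
proof (induction "is" arbitrary: s w)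
  case (Cons k "is")
  have k: "k \<notin> Z" "deg G k \<le> s k" "legal G Z (topple G Z k s) is"
    using Cons.prems(1) by (auto simp: unstable_def)
  have "w k \<noteq> 0"
    using laplacian_nonneg_at_zero[of w k] Cons.prems(2) Cons.prems(3)[of k] k by auto
  then have wk: "w k \<ge> 1"
    using Cons.prems(2)[of k] by linarith
  have "int (count_list is i) \<le> w i - delta k i"
  proof (rule Cons.IH[OF k(3)])
    show "w i - delta k i \<ge> 0" for i
      using wk Cons.prems(2)[of i] by (auto simp: delta_def)
    show "topple G Z k s j + laplacian G (\<lambda>i. w i - delta k i) j < deg G j" if "j \<notin> Z" for j
      using that Cons.prems(3)[of j] by (simp add: topple_def laplacian_diff)
  qed
  then show ?case
    by (auto simp: delta_def)
qed simp

text \<open>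
  Abelianness: the toppling numbers of two stabilizing sequences bound each other by least
  action, hence agree, and they determine the result.
\<close>

lemma stabilization_eq:
  assumes "stabilizing G Z s is"
  shows "stabilization G Z s = fold (topple G Z) is s"
  unfolding stabilization_def
proof (rule the_equality)
  show "\<exists>is'. stabilizing G Z s is' \<and> fold (topple G Z) is s = fold (topple G Z) is' s"
    using assms by blast
  fix t assume "\<exists>is'. stabilizing G Z s is' \<and> t = fold (topple G Z) is' s"
  then obtain is' where is': "stabilizing G Z s is'" "t = fold (topple G Z) is' s"
    by blast
  have "int (count_list is i) \<le> int (count_list is' i)" for i
    using assms is' by (intro least_action[of Z s]) (auto simp: stabilizing_iff)
  moreover have "int (count_list is' i) \<le> int (count_list is i)" for i
    using assms is' by (intro least_action[of Z s]) (auto simp: stabilizing_iff)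
  ultimately have "count_list is' i = count_list is i" for i
    by (simp add: order.antisym)
  then show "t = fold (topple G Z) is s"
    unfolding is'(2) fold_topple by (simp cong: if_cong)
qed

text \<open>
  By least action the total of \<open>w\<close> bounds the length of legal sequences, and a longest one
  cannot be extended.
\<close>

lemma stabilizableI:
  assumes "\<And>i. w i \<ge> 0" and "\<And>j. j \<notin> Z \<Longrightarrow> s j + laplacian G w j < deg G j"
  shows "stabilizable G Z s"
proof -
  have bound: "length is \<le> nat (\<Sum>i\<in>UNIV. w i)" if "legal G Z s is" for "is"
  proof -
    have "int (length is) = (\<Sum>i\<in>UNIV. int (count_list is i))"
      using sum_count_set[of "is" UNIV] by (simp flip: of_nat_sum)
    also have "\<dots> \<le> (\<Sum>i\<in>UNIV. w i)"
      by (intro sum_mono least_action[OF that]) (use assms in auto)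
    finally show ?thesis by simp
  qed
  obtain js where js: "legal G Z s js" "\<And>is. legal G Z s is \<Longrightarrow> length is \<le> length js"
    using ex_has_greatest_nat[of "legal G Z s" "[]" length "Suc (nat (\<Sum>i\<in>UNIV. w i))"] bound
    by (metis le_imp_less_Suc legal.simps(1))
  have "\<not> unstable G (fold (topple G Z) js s) i" if "i \<notin> Z" for i
    using js(2)[of "js @ [i]"] js(1) that by (auto simp: legal_append)
  then show ?thesis
    using js(1) by (auto simp: stabilizable_def stabilizing_def)
qed

text \<open>
  Here \<open>w\<close> may have any sign, as adding a constant to it changes nothing. The criterion shows
  that stabilizability depends only on the class of \<open>s\<close> modulo the image of the Laplacian.
\<close>

lemma stabilizable_iff:
  "stabilizable G {} s \<longleftrightarrow> (\<exists>w. \<forall>j. s j + laplacian G w j < deg G j)"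
proof
  assume "\<exists>w. \<forall>j. s j + laplacian G w j < deg G j"
  then obtain w where w: "\<And>j. s j + laplacian G w j < deg G j"
    by blast
  show "stabilizable G {} s"
  proof (rule stabilizableI[where w = "\<lambda>i. w i - Min (range w)"])
    show "s j + laplacian G (\<lambda>i. w i - Min (range w)) j < deg G j" for j
      using w by (simp add: laplacian_shift)
  qed simp
qed (auto simp: stabilizable_def stabilizing_iff)

lemma stabilizable_sink: "stabilizable G {z} s"
proof -
  obtain h where h: "\<And>i. h i \<ge> 0" "\<And>i. i \<noteq> z \<Longrightarrow> laplacian G h i \<le> -1"
    using ex_strictly_superharmonic[of z] by blast
  define N where "N = (\<Sum>i\<in>UNIV. \<bar>s i\<bar>) + 1"
  have N: "s i < N" for i
    using member_le_sum[of i UNIV "\<lambda>i. \<bar>s i\<bar>"] by (simp add: N_def)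
  have N_pos: "N > 0"
    by (simp add: N_def sum_nonneg add_nonneg_pos)
  show ?thesis
  proof (rule stabilizableI[where w = "\<lambda>i. N * h i"])
    show "N * h i \<ge> 0" for i
      using h N_pos by simp
    fix j assume "j \<notin> {z}"
    then have "N * laplacian G h j \<le> N * (-1)"
      using h N_pos by (intro mult_left_mono) auto
    then show "s j + laplacian G (\<lambda>i. N * h i) j < deg G j"
      unfolding laplacian_scale using N[of j] deg_nonneg[of j] by linarith
  qed
qed

lemma add_op_eq_add_laplacian: "\<exists>w. add_op G i s = (\<lambda>j. s j + delta i j + laplacian G w j)"
proof (cases "stabilizable G {} (\<lambda>j. s j + delta i j)")
  case True
  then obtain "is" where "stabilizing G {} (\<lambda>j. s j + delta i j) is"
    by (auto simp: stabilizable_def)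
  then have "add_op G i s = fold (topple G {}) is (\<lambda>j. s j + delta i j)"
    using True by (simp add: add_op_def stabilization_eq)
  then show ?thesis
    by (auto simp: fold_topple)
next
  case False
  then show ?thesis
    by (auto simp: add_op_def intro!: exI[of _ "\<lambda>_. 0"])
qed

section \<open>Recurrent sandpiles\<close>

text \<open>
  Dhar's burning criterion: if all vertices outside \<open>A\<close> fire once, some vertex of \<open>A\<close> holds at
  least as many chips as its degree. The sets for which this fails are the forbidden
  subconfigurations.
\<close>

definition forbidden_free :: "'v \<Rightarrow> 'v sandpile \<Rightarrow> bool" where
  "forbidden_free z s \<longleftrightarrow>
    (\<forall>A. A \<noteq> {} \<longrightarrow> z \<notin> A \<longrightarrow> (\<exists>i\<in>A. deg G i \<le> s i + (\<Sum>j\<in>-A. arc_mult G j i)))"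

lemma forbidden_freeD:
  assumes "forbidden_free z s" "A \<noteq> {}" "z \<notin> A"
  obtains i where "i \<in> A" "deg G i \<le> s i + (\<Sum>j\<in>-A. arc_mult G j i)"
  using assms by (auto simp: forbidden_free_def)

lemma forbidden_free_mono:
  assumes "forbidden_free z s" and "\<And>i. i \<noteq> z \<Longrightarrow> s i \<le> t i"
  shows "forbidden_free z t"
  unfolding forbidden_free_def
proof (intro allI impI)
  fix A :: "'v set" assume A: "A \<noteq> {}" "z \<notin> A"
  obtain i where i: "i \<in> A" "deg G i \<le> s i + (\<Sum>j\<in>-A. arc_mult G j i)"
    using forbidden_freeD[OF assms(1) A] .
  moreover have "s i \<le> t i"
    using i A assms(2)[of i] by auto
  ultimately show "\<exists>i\<in>A. deg G i \<le> t i + (\<Sum>j\<in>-A. arc_mult G j i)"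
    by (intro bexI[of _ i]) auto
qed

lemma sum_Compl_diff_singleton:
  fixes f :: "'v \<Rightarrow> int"
  assumes "k \<in> A"
  shows "(\<Sum>j\<in>-(A - {k}). f j) = f k + (\<Sum>j\<in>-A. f j)"
proof -
  have "-(A - {k}) = insert k (-A)"
    using assms by auto
  then show ?thesis
    using assms by simp
qed

text \<open>
  Toppling \<open>k\<close> hurts only \<open>k\<close> itself. For \<open>k \<in> A\<close> the vertex that the criterion supplies for
  \<open>A - {k}\<close> serves for \<open>A\<close> as well: it has received from \<open>k\<close> the chips that the criterion counted
  as coming from outside \<open>A - {k}\<close>. If \<open>A = {k}\<close>, the chips from outside restore what \<open>k\<close> gave away.
\<close>

lemma forbidden_free_topple:
  assumes "forbidden_free z s" "k \<noteq> z" "unstable G s k"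
  shows "forbidden_free z (topple G {z} k s)"
  unfolding forbidden_free_def
proof (intro allI impI)
  fix A :: "'v set" assume A: "A \<noteq> {}" "z \<notin> A"
  have val: "topple G {z} k s i = s i + arc_mult G k i - (if k = i then deg G i else 0)"
    if "i \<in> A" for i
    using that A by (auto simp: topple_def laplacian_delta)
  consider "k \<notin> A" | "A = {k}" | "k \<in> A" "A - {k} \<noteq> {}"
    by blast
  then show "\<exists>i\<in>A. deg G i \<le> topple G {z} k s i + (\<Sum>j\<in>-A. arc_mult G j i)"
  proof cases
    case 1
    obtain i where i: "i \<in> A" "deg G i \<le> s i + (\<Sum>j\<in>-A. arc_mult G j i)"
      using forbidden_freeD[OF assms(1) A] .
    then show ?thesis
      using val[of i] 1 by (intro bexI[of _ i]) (auto intro: order.trans)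
  next
    case 2
    have "deg G k = arc_mult G k k + (\<Sum>j\<in>-A. arc_mult G j k)"
      using sum_Compl_diff_singleton[of k A "\<lambda>j. arc_mult G j k"] 2
      by (simp add: sum_arc_mult_in)
    then show ?thesis
      using 2 val[of k] assms(3) by (intro bexI[of _ k]) (auto simp: unstable_def)
  next
    case 3
    obtain i where i: "i \<in> A - {k}" "deg G i \<le> s i + (\<Sum>j\<in>-(A - {k}). arc_mult G j i)"
      using forbidden_freeD[OF assms(1) 3(2)] A by blast
    then show ?thesis
      using val[of i] 3(1) by (intro bexI[of _ i]) (auto simp: sum_Compl_diff_singleton)
  qed
qed

lemma forbidden_free_legal:
  "legal G {z} s is \<Longrightarrow> forbidden_free z s \<Longrightarrow> forbidden_free z (fold (topple G {z}) is s)"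
  by (induction "is" arbitrary: s) (auto intro: forbidden_free_topple)

text \<open>
  The vertex of \<open>A\<close> that topples first has by then received chips only from outside \<open>A\<close>, at most
  once from every vertex.
\<close>

lemma first_toppling_in_set:
  assumes "legal G {z} s is" "distinct is" "A \<subseteq> set is" "A \<noteq> {}"
  shows "\<exists>i\<in>A. deg G i \<le> s i + (\<Sum>j\<in>set is - A. arc_mult G j i)"
  using assms
proof (induction "is" arbitrary: s)
  case (Cons k "is")
  show ?case
  proof (cases "k \<in> A")
    case True
    have "0 \<le> (\<Sum>j\<in>set (k # is) - A. arc_mult G j k)"
      by (intro sum_nonneg) simp
    then have "deg G k \<le> s k + (\<Sum>j\<in>set (k # is) - A. arc_mult G j k)"
      using Cons.prems(1) unfolding legal.simps unstable_def by linarith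
    then show ?thesis
      using True by blast
  next
    case False
    then have A: "A \<subseteq> set is"
      using Cons.prems(3) by auto
    then obtain i where i: "i \<in> A"
      "deg G i \<le> topple G {z} k s i + (\<Sum>j\<in>set is - A. arc_mult G j i)"
      using Cons.IH[of "topple G {z} k s"] Cons.prems by auto
    have "i \<noteq> z"
      using i A Cons.prems(1) legal_sinks_unused[of "{z}" s "k # is" i] by auto
    then have "topple G {z} k s i = s i + arc_mult G k i"
      using i False by (auto simp: topple_def laplacian_delta)
    moreover have "set (k # is) - A = insert k (set is - A)" "k \<notin> set is - A"
      using False Cons.prems(2) by auto
    ultimately show ?thesis
      using i by (intro bexI[of _ i]) simp_all
  qed
qed simp

text \<open>
  Here \<open>A\<close> is the set of vertices that are still to topple, and \<open>s\<close> is \<open>\<rho>\<close> after every vertex outside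
  \<open>A\<close> has fired once. The criterion for \<open>A\<close> names a vertex that can topple next. In the end every
  vertex has fired once, which restores \<open>\<rho>\<close> off \<open>z\<close>.
\<close>

lemma burning_sequence:
  assumes ff: "forbidden_free z \<rho>" and stable: "\<And>i. i \<noteq> z \<Longrightarrow> \<rho> i < deg G i" and "z \<notin> A"
    and "\<And>i. i \<noteq> z \<Longrightarrow> s i = \<rho> i + laplacian G (\<lambda>j. if j \<in> A then 0 else 1) i"
  shows "\<exists>is. stabilizing G {z} s is \<and> distinct is \<and> set is = A"
  using finite[of A] assms(3,4)
proof (induction A arbitrary: s rule: finite_psubset_induct)
  case (psubset A)
  show ?case
  proof (cases "A = {}")
    case True
    then have "stabilizing G {z} s []"
      using psubset.prems(2) stable by (auto simp: stabilizing_iff)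
    then show ?thesis
      using True by auto
  next
    case False
    obtain k where k: "k \<in> A" "deg G k \<le> \<rho> k + (\<Sum>j\<in>-A. arc_mult G j k)"
      using forbidden_freeD[OF ff False psubset.prems(1)] .
    have kz: "k \<noteq> z"
      using k psubset.prems by auto
    have "laplacian G (\<lambda>j. if j \<in> A then 0 else 1) k = (\<Sum>j\<in>UNIV. if j \<in> -A then arc_mult G j k else 0)"
      unfolding laplacian_eq_sum_differences using k by (intro sum.cong) auto
    also have "\<dots> = (\<Sum>j\<in>-A. arc_mult G j k)"
      by (simp add: sum.If_cases Compl_eq)
    finally have unstable: "unstable G s k"
      using k kz psubset.prems(2)[of k] by (simp add: unstable_def)
    have "(\<lambda>j. if j \<in> A - {k} then 0 else 1) = (\<lambda>j. (if j \<in> A then 0 else 1) + delta k j)"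
      using k by (auto simp: delta_def fun_eq_iff)
    then have "topple G {z} k s i = \<rho> i + laplacian G (\<lambda>j. if j \<in> A - {k} then 0 else 1) i" if "i \<noteq> z" for i
      using that psubset.prems(2)[of i] by (simp add: topple_def laplacian_add)
    then obtain "is" where "is": "stabilizing G {z} (topple G {z} k s) is" "distinct is" "set is = A - {k}"
      using psubset.IH[of "A - {k}" "topple G {z} k s"] psubset.prems(1) k by auto
    have "stabilizing G {z} s (k # is)"
      using "is" unstable kz by (simp add: stabilizing_def)
    then show ?thesis
      using "is" k by (intro exI[of _ "k # is"]) auto
  qed
qed

lemma recurrent_iff:
  "recurrent G z \<rho> \<longleftrightarrow>
    \<rho> z = deg G z \<and> (\<forall>i. i \<noteq> z \<longrightarrow> \<rho> i < deg G i) \<and> forbidden_free z \<rho>"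
proof
  assume rec: "recurrent G z \<rho>"
  then obtain "is" where legal: "legal G {z} (\<lambda>j. \<rho> j + laplacian G (delta z) j) is"
    and once: "\<And>i. i \<noteq> z \<Longrightarrow> count_list is i = 1"
    by (auto simp: recurrent_def stabilizing_def)
  have z: "z \<notin> set is"
    using legal_sinks_unused[OF legal] by auto
  have set: "set is = -{z}"
  proof -
    have "i \<in> set is" if "i \<noteq> z" for i
      using once[OF that] count_list_0_iff[of "is" i] by auto
    then show ?thesis
      using z by auto
  qed
  then have "distinct is"
    using once by (auto simp: distinct_count_atmost_1 count_mset count_list_0_iff)
  have "forbidden_free z \<rho>"
    unfolding forbidden_free_def
  proof (intro allI impI)
    fix A :: "'v set" assume A: "A \<noteq> {}" "z \<notin> A"
    then obtain i where i: "i \<in> A"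
      "deg G i \<le> \<rho> i + laplacian G (delta z) i + (\<Sum>j\<in>set is - A. arc_mult G j i)"
      using first_toppling_in_set[OF legal \<open>distinct is\<close>, of A] set by auto
    have "-A = insert z (set is - A)" "z \<notin> set is - A"
      using A set by auto
    then have "(\<Sum>j\<in>-A. arc_mult G j i) = arc_mult G z i + (\<Sum>j\<in>set is - A. arc_mult G j i)"
      by simp
    then show "\<exists>i\<in>A. deg G i \<le> \<rho> i + (\<Sum>j\<in>-A. arc_mult G j i)"
      using i A by (intro bexI[of _ i]) (auto simp: laplacian_delta split: if_splits)
  qed
  then show "\<rho> z = deg G z \<and> (\<forall>i. i \<noteq> z \<longrightarrow> \<rho> i < deg G i) \<and> forbidden_free z \<rho>"
    using rec by (auto simp: recurrent_def)
next
  assume *: "\<rho> z = deg G z \<and> (\<forall>i. i \<noteq> z \<longrightarrow> \<rho> i < deg G i) \<and> forbidden_free z \<rho>"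
  have "delta z = (\<lambda>j. if j \<in> -{z} then 0 else 1)"
    by (auto simp: delta_def)
  then obtain "is" where "stabilizing G {z} (\<lambda>j. \<rho> j + laplacian G (delta z) j) is" "distinct is"
    "set is = -{z}"
    using burning_sequence[of z \<rho> "-{z}" "\<lambda>j. \<rho> j + laplacian G (delta z) j"] * by auto
  moreover from this have "count_list is i = 1" if "i \<noteq> z" for i
    using that by (metis ComplI count_mset distinct_count_atmost_1 singletonD)
  ultimately show "recurrent G z \<rho>"
    unfolding recurrent_def using * by auto
qed


section \<open>Recurrent representatives\<close>

text \<open>
  Let \<open>A\<close> be the set where \<open>w\<close> is minimal. Relative to \<open>A\<close>, every vertex outside has fired at least
  once. If \<open>A\<close> did not contain \<open>z\<close>, the criterion would yield an unstable vertex in \<open>A\<close>.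

  This lemma gives both the uniqueness of recurrent representatives and the characterization
  of the stabilizable sandpiles.
\<close>

lemma stable_imp_min_at_sink:
  assumes ff: "forbidden_free z s" and stable: "\<And>j. j \<noteq> z \<Longrightarrow> s j + laplacian G w j < deg G j"
  shows "w z \<le> w i"
proof -
  define m where "m = Min (range w)"
  have m: "m \<le> w j" for j
    by (simp add: m_def)
  define A where "A = {j. w j = m}"
  have "m \<in> range w"
    unfolding m_def by (rule Min_in) auto
  then have "A \<noteq> {}"
    by (auto simp: A_def)
  have "z \<in> A"
  proof (rule ccontr)
    assume "z \<notin> A"
    then obtain k where k: "k \<in> A" "deg G k \<le> s k + (\<Sum>j\<in>-A. arc_mult G j k)"
      using forbidden_freeD[OF ff \<open>A \<noteq> {}\<close>] by blast
    have "(\<Sum>j\<in>-A. arc_mult G j k) = (\<Sum>j\<in>UNIV. if j \<in> -A then arc_mult G j k else 0)"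
      by (simp add: sum.If_cases Compl_eq)
    also have "\<dots> \<le> (\<Sum>j\<in>UNIV. arc_mult G j k * (w j - w k))"
    proof (rule sum_mono)
      fix j
      have "w k = m" using k by (simp add: A_def)
      have "arc_mult G j k * 1 \<le> arc_mult G j k * (w j - w k)" if "j \<in> -A"
        using that m[of j] \<open>w k = m\<close> by (intro mult_left_mono) (auto simp: A_def)
      moreover have "0 \<le> arc_mult G j k * (w j - w k)"
        using m[of j] \<open>w k = m\<close> by simp
      ultimately show "(if j \<in> -A then arc_mult G j k else 0) \<le> arc_mult G j k * (w j - w k)"
        by simp
    qed
    also have "\<dots> = laplacian G w k"
      by (simp add: laplacian_eq_sum_differences)
    finally have "deg G k \<le> s k + laplacian G w k"
      using k by simp
    moreover have "k \<noteq> z"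
      using k \<open>z \<notin> A\<close> by auto
    ultimately show False
      using stable[of k] by simp
  qed
  then show ?thesis
    using m[of i] by (simp add: A_def)
qed

text \<open>
  Leaving the value at \<open>z\<close> free accounts for the multiple of \<open>\<delta>\<^sub>z\<close>.
\<close>

definition equiv_off_sink :: "'v \<Rightarrow> 'v sandpile \<Rightarrow> 'v sandpile \<Rightarrow> bool" where
  "equiv_off_sink z s t \<longleftrightarrow> (\<exists>v. \<forall>j. j \<noteq> z \<longrightarrow> s j = t j + laplacian G v j)"

lemma equiv_off_sinkI: "(\<And>j. j \<noteq> z \<Longrightarrow> s j = t j + laplacian G v j) \<Longrightarrow> equiv_off_sink z s t"
  by (auto simp: equiv_off_sink_def)

lemma equiv_off_sink_refl: "equiv_off_sink z s s"
  by (rule equiv_off_sinkI[where v = "\<lambda>_. 0"]) simp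

lemma equiv_off_sink_sym: "equiv_off_sink z s t \<Longrightarrow> equiv_off_sink z t s"
proof -
  assume "equiv_off_sink z s t"
  then obtain v where "\<And>j. j \<noteq> z \<Longrightarrow> s j = t j + laplacian G v j"
    by (auto simp: equiv_off_sink_def)
  then show ?thesis
    by (intro equiv_off_sinkI[where v = "\<lambda>j. - v j"]) (simp add: laplacian_minus)
qed

lemma equiv_off_sink_trans:
  assumes "equiv_off_sink z r s" "equiv_off_sink z s t"
  shows "equiv_off_sink z r t"
proof -
  obtain v w where "\<And>j. j \<noteq> z \<Longrightarrow> r j = s j + laplacian G v j"
    "\<And>j. j \<noteq> z \<Longrightarrow> s j = t j + laplacian G w j"
    using assms by (auto simp: equiv_off_sink_def)
  then show ?thesis
    by (intro equiv_off_sinkI[where v = "\<lambda>j. w j + v j"]) (simp add: laplacian_add)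
qed

lemma equiv_off_sink_add:
  "equiv_off_sink z (\<lambda>j. s j + f j) (\<lambda>j. t j + f j) \<longleftrightarrow> equiv_off_sink z s t"
  by (auto simp: equiv_off_sink_def)

lemma Rec_iff:
  "\<rho> \<in> Rec G z \<longleftrightarrow> \<rho> z = deg G z \<and> (\<forall>i. i \<noteq> z \<longrightarrow> \<rho> i < deg G i) \<and> forbidden_free z \<rho>"
  by (simp add: Rec_def recurrent_iff)

text \<open>
  Off \<open>z\<close>, two equivalent recurrent sandpiles differ by the Laplacian of some \<open>v\<close>. As either
  sandpile is stable off \<open>z\<close> and burns, both \<open>v\<close> and \<open>-v\<close> are minimal at \<open>z\<close>; so \<open>v\<close> is constant.
\<close>

lemma Rec_unique:
  assumes "\<rho> \<in> Rec G z" "\<sigma> \<in> Rec G z" "equiv_off_sink z \<rho> \<sigma>"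
  shows "\<rho> = \<sigma>"
proof -
  obtain v where v: "\<And>j. j \<noteq> z \<Longrightarrow> \<rho> j = \<sigma> j + laplacian G v j"
    using assms(3) by (auto simp: equiv_off_sink_def)
  have min: "v z \<le> v i" for i
  proof (rule stable_imp_min_at_sink)
    show "forbidden_free z \<sigma>"
      using assms by (simp add: Rec_iff)
    show "\<sigma> j + laplacian G v j < deg G j" if "j \<noteq> z" for j
      unfolding v[OF that, symmetric] using that assms(1) by (simp add: Rec_iff)
  qed
  have max: "- v z \<le> - v i" for i
  proof (rule stable_imp_min_at_sink)
    show "forbidden_free z \<rho>"
      using assms by (simp add: Rec_iff)
    show "\<rho> j + laplacian G (\<lambda>i. - v i) j < deg G j" if "j \<noteq> z" for j
      using that v[of j] assms(2) by (simp add: Rec_iff laplacian_minus)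
  qed
  have eq: "v i - v j = 0" for i j
    using min[of i] min[of j] max[of i] max[of j] by linarith
  have "laplacian G v j = 0" for j
    unfolding laplacian_eq_sum_differences eq by simp
  then have "\<rho> j = \<sigma> j" for j
    using v[of j] assms by (cases "j = z") (auto simp: Rec_iff)
  then show ?thesis
    by blast
qed

lemma stabilization_sink:
  obtains u where "\<And>i. u i \<ge> 0" and "u z = 0"
    and "\<And>j. j \<noteq> z \<Longrightarrow> stabilization G {z} s j = s j + laplacian G u j"
    and "\<And>j. j \<noteq> z \<Longrightarrow> stabilization G {z} s j < deg G j"
    and "forbidden_free z s \<Longrightarrow> forbidden_free z (stabilization G {z} s)"
proof -
  obtain "is" where "is": "stabilizing G {z} s is"
    using stabilizable_sink by (auto simp: stabilizable_def)
  have legal: "legal G {z} s is"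
    using "is" by (simp add: stabilizing_def)
  have "z \<notin> set is"
    using legal_sinks_unused[OF legal] by auto
  then show thesis
    using that[of "\<lambda>i. int (count_list is i)"] "is" forbidden_free_legal[OF legal]
    by (auto simp: stabilization_eq fold_topple stabilizing_iff)
qed

lemma stabilization_sink_in_Rec:
  assumes "forbidden_free z s"
  shows "(stabilization G {z} s)(z := deg G z) \<in> Rec G z"
    and "equiv_off_sink z s ((stabilization G {z} s)(z := deg G z))"
proof -
  obtain u where u: "\<And>j. j \<noteq> z \<Longrightarrow> stabilization G {z} s j = s j + laplacian G u j"
    "\<And>j. j \<noteq> z \<Longrightarrow> stabilization G {z} s j < deg G j"
    "forbidden_free z (stabilization G {z} s)"
    using stabilization_sink[of z s] assms by metis
  show "(stabilization G {z} s)(z := deg G z) \<in> Rec G z"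
    using u(2) forbidden_free_mono[OF u(3), of "(stabilization G {z} s)(z := deg G z)"]
    by (auto simp: Rec_iff)
  show "equiv_off_sink z s ((stabilization G {z} s)(z := deg G z))"
    by (rule equiv_off_sink_sym, rule equiv_off_sinkI[where v = u]) (use u(1) in auto)
qed

lemma ex_equiv_ge:
  obtains s' where "equiv_off_sink z s s'" and "\<And>j. j \<noteq> z \<Longrightarrow> s' j \<ge> b j" and "s' z = s z"
proof -
  obtain h where h: "\<And>i. h i \<ge> 0" "\<And>i. i \<noteq> z \<Longrightarrow> laplacian G h i \<le> -1"
    using ex_strictly_superharmonic[of z] by blast
  define N where "N = (\<Sum>i\<in>UNIV. \<bar>b i - s i\<bar>)"
  have N: "b i - s i \<le> N" for i
    using member_le_sum[of i UNIV "\<lambda>i. \<bar>b i - s i\<bar>"] by (simp add: N_def)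
  have "N \<ge> 0"
    by (simp add: N_def sum_nonneg)
  show thesis
  proof (rule that[of "\<lambda>j. if j = z then s z else s j - laplacian G (\<lambda>i. N * h i) j"])
    fix j assume "j \<noteq> z"
    then have "N * laplacian G h j \<le> N * (-1)"
      using h \<open>N \<ge> 0\<close> by (intro mult_left_mono) auto
    then show "b j \<le> (if j = z then s z else s j - laplacian G (\<lambda>i. N * h i) j)"
      using N[of j] \<open>j \<noteq> z\<close> by (simp add: laplacian_scale)
  qed (auto intro: equiv_off_sinkI)
qed

text \<open>
  A sandpile that is unstable everywhere off \<open>z\<close> satisfies the burning criterion trivially, and
  stabilizing it preserves the criterion.
\<close>

lemma ex_Rec_equiv: "\<exists>\<rho>\<in>Rec G z. equiv_off_sink z s \<rho>"
proof -
  obtain s' where s': "equiv_off_sink z s s'" "\<And>j. j \<noteq> z \<Longrightarrow> s' j \<ge> deg G j"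
    using ex_equiv_ge[of z s "deg G"] by blast
  have "forbidden_free z s'"
    unfolding forbidden_free_def
  proof (intro allI impI)
    fix A :: "'v set" assume A: "A \<noteq> {}" "z \<notin> A"
    then obtain i where "i \<in> A" "i \<noteq> z" by blast
    moreover have "0 \<le> (\<Sum>j\<in>-A. arc_mult G j i)"
      by (intro sum_nonneg) simp
    ultimately show "\<exists>i\<in>A. deg G i \<le> s' i + (\<Sum>j\<in>-A. arc_mult G j i)"
      using s'(2)[of i] by (intro bexI[of _ i]) linarith+
  qed
  then show ?thesis
    using stabilization_sink_in_Rec[of z s'] equiv_off_sink_trans[OF s'(1)] by blast
qed

lemma equiv_off_sink_iff:
  "equiv_off_sink z s \<rho> \<longleftrightarrow>
    (\<exists>(m::int) v. v z = 0 \<and> s = (\<lambda>j. \<rho> j + m * delta z j + laplacian G v j))"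
proof
  assume "equiv_off_sink z s \<rho>"
  then obtain v where v: "\<And>j. j \<noteq> z \<Longrightarrow> s j = \<rho> j + laplacian G v j"
    by (auto simp: equiv_off_sink_def)
  show "\<exists>(m::int) v. v z = 0 \<and> s = (\<lambda>j. \<rho> j + m * delta z j + laplacian G v j)"
    \<comment> \<open>Subtracting the constant \<open>v z\<close> arranges \<open>v z = 0\<close> without changing the Laplacian.\<close>
    by (rule exI[of _ "s z - \<rho> z - laplacian G v z"], rule exI[of _ "\<lambda>i. v i - v z"])
      (auto simp: laplacian_shift delta_def fun_eq_iff v)
next
  assume "\<exists>(m::int) v. v z = 0 \<and> s = (\<lambda>j. \<rho> j + m * delta z j + laplacian G v j)"
  then show "equiv_off_sink z s \<rho>"
    by (auto simp: equiv_off_sink_def delta_def)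
qed

lemma rec_rep_eq:
  assumes "\<rho> \<in> Rec G z" "equiv_off_sink z s \<rho>"
  shows "rec_rep G z s = \<rho>"
  unfolding rec_rep_def equiv_off_sink_iff[symmetric]
  using assms by (blast intro: Rec_unique equiv_off_sink_trans equiv_off_sink_sym)

lemma rec_rep_in_Rec: "rec_rep G z s \<in> Rec G z"
  and equiv_rec_rep: "equiv_off_sink z s (rec_rep G z s)"
  using ex_Rec_equiv[of z s] rec_rep_eq by auto

lemma rec_rep_cong: "equiv_off_sink z s t \<Longrightarrow> rec_rep G z s = rec_rep G z t"
  by (meson equiv_off_sink_trans equiv_rec_rep rec_rep_eq rec_rep_in_Rec)

text \<open>
  Let \<open>\<rho>\<close> be the representative and \<open>m\<close> the multiple of \<open>\<delta>\<^sub>z\<close> in the decomposition of \<open>s\<close>; the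
  number of chips gives \<open>m = |s| - |\<rho>|\<close>. For \<open>m < 0\<close> the sandpile \<open>\<rho> + m \<delta>\<^sub>z\<close> is stable. For
  \<open>m \<ge> 0\<close>, any \<open>u\<close> that stabilizes it would be minimal at \<open>z\<close> because \<open>\<rho>\<close> burns; then \<open>z\<close> loses
  no chips and keeps at least \<open>deg z\<close> of them.
\<close>

lemma stabilizable_iff_num_chips:
  "stabilizable G {} s \<longleftrightarrow> num_chips s < num_chips (rec_rep G z s)"
proof -
  define \<rho> where "\<rho> = rec_rep G z s"
  have \<rho>: "\<rho> z = deg G z" "\<And>i. i \<noteq> z \<Longrightarrow> \<rho> i < deg G i" "forbidden_free z \<rho>"
    using rec_rep_in_Rec[of z s] by (auto simp: \<rho>_def Rec_iff)
  obtain m v where s: "s = (\<lambda>j. \<rho> j + m * delta z j + laplacian G v j)"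
    using equiv_rec_rep[of z s] by (auto simp: \<rho>_def equiv_off_sink_iff)
  have num: "num_chips s = num_chips \<rho> + m"
    by (simp add: s num_chips_add_laplacian num_chips_add_delta)
  have "stabilizable G {} s \<longleftrightarrow> m < 0"
  proof
    assume "m < 0"
    show "stabilizable G {} s"
      unfolding stabilizable_iff
    proof (intro exI[of _ "\<lambda>i. - v i"] allI)
      show "s j + laplacian G (\<lambda>i. - v i) j < deg G j" for j
        using \<rho>(1) \<rho>(2)[of j] \<open>m < 0\<close> by (auto simp: s laplacian_minus delta_def)
    qed
  next
    assume "stabilizable G {} s"
    then obtain w where w: "\<And>j. s j + laplacian G w j < deg G j"
      by (auto simp: stabilizable_iff)
    define u where "u = (\<lambda>i. v i + w i)"
    have u: "\<rho> j + m * delta z j + laplacian G u j < deg G j" for j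
      using w[of j] by (simp add: s u_def laplacian_add)
    have "u z \<le> u i" for i
      by (rule stable_imp_min_at_sink[OF \<rho>(3)])
        (use u in \<open>force simp: delta_def split: if_splits\<close>)
    then have "laplacian G (\<lambda>i. u i - u z) z \<ge> 0"
      by (intro laplacian_nonneg_at_zero) auto
    then show "m < 0"
      using u[of z] \<rho>(1) by (simp add: laplacian_shift delta_def)
  qed
  then show ?thesis
    using num by (simp add: \<rho>_def)
qed

lemma Rec_bounds: "\<rho> \<in> Rec G z \<Longrightarrow> 0 \<le> \<rho> i \<and> \<rho> i \<le> deg G i"
proof (cases "i = z")
  case False
  assume \<rho>: "\<rho> \<in> Rec G z"
  then have "deg G i \<le> \<rho> i + (\<Sum>j\<in>-{i}. arc_mult G j i)"
    using forbidden_freeD[of z \<rho> "{i}"] False by (auto simp: Rec_iff)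
  moreover have "(\<Sum>j\<in>-{i}. arc_mult G j i) \<le> deg G i"
    unfolding sum_arc_mult_in[symmetric] by (intro sum_mono2) auto
  ultimately show ?thesis
    using \<rho> False by (force simp: Rec_iff)
qed (simp add: Rec_iff)

lemma num_chips_Rec_nonneg: "\<rho> \<in> Rec G z \<Longrightarrow> 0 \<le> num_chips \<rho>"
  using Rec_bounds by (auto simp: num_chips_def intro!: sum_nonneg)

lemma num_chips_Rec_le: "\<rho> \<in> Rec G z \<Longrightarrow> num_chips \<rho> \<le> (\<Sum>i\<in>UNIV. deg G i)"
  using Rec_bounds by (auto simp: num_chips_def intro!: sum_mono)

lemma finite_Rec: "finite (Rec G z)"
proof (rule finite_subset)
  show "Rec G z \<subseteq> PiE UNIV (\<lambda>i. {0..deg G i})"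
    using Rec_bounds by (auto simp: PiE_def Pi_def)
qed (intro finite_PiE, auto)

section \<open>The addition operators on recurrent sandpiles\<close>

lemma forbidden_free_add_delta:
  "\<rho> \<in> Rec G z \<Longrightarrow> forbidden_free z (\<lambda>j. \<rho> j + delta i j)"
  by (rule forbidden_free_mono[of z \<rho>]) (auto simp: Rec_iff delta_def)

lemma open_add_op_in_Rec: "\<rho> \<in> Rec G z \<Longrightarrow> open_add_op G z i \<rho> \<in> Rec G z"
  unfolding open_add_op_def by (intro stabilization_sink_in_Rec forbidden_free_add_delta)

lemma equiv_open_add_op:
  "\<rho> \<in> Rec G z \<Longrightarrow> equiv_off_sink z (\<lambda>j. \<rho> j + delta i j) (open_add_op G z i \<rho>)"
  unfolding open_add_op_def by (intro stabilization_sink_in_Rec forbidden_free_add_delta)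

text \<open>
  Passing to representatives turns the addition of a chip into the open addition operator.
\<close>

lemma rec_rep_add_delta:
  "rec_rep G z (\<lambda>j. s j + delta i j) = open_add_op G z i (rec_rep G z s)"
proof (rule rec_rep_eq)
  have "equiv_off_sink z (\<lambda>j. s j + delta i j) (\<lambda>j. rec_rep G z s j + delta i j)"
    by (simp add: equiv_off_sink_add equiv_rec_rep)
  then show "equiv_off_sink z (\<lambda>j. s j + delta i j) (open_add_op G z i (rec_rep G z s))"
    using equiv_off_sink_trans equiv_open_add_op rec_rep_in_Rec by blast
qed (simp add: open_add_op_in_Rec rec_rep_in_Rec)

text \<open>
  A chip is added and the Laplacian conserves chips, so the only change left is the reset at
  \<open>z\<close>, which discards the chips that have arrived there.
\<close>

lemma num_chips_open_add_op:
  assumes "\<rho> \<in> Rec G z"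
  shows "num_chips (open_add_op G z i \<rho>) \<le> num_chips \<rho> + 1"
proof -
  define s where "s = (\<lambda>j. \<rho> j + delta i j)"
  obtain u where u: "\<And>i. u i \<ge> 0" "u z = 0"
    "\<And>j. j \<noteq> z \<Longrightarrow> stabilization G {z} s j = s j + laplacian G u j"
    using stabilization_sink[of z s] by metis
  have "open_add_op G z i \<rho> j \<le> s j + laplacian G u j" for j
    using laplacian_nonneg_at_zero[of u z] u assms
    by (cases "j = z") (auto simp: open_add_op_def s_def[symmetric], auto simp: s_def Rec_iff delta_def)
  then have "num_chips (open_add_op G z i \<rho>) \<le> num_chips (\<lambda>j. s j + laplacian G u j)"
    by (simp add: num_chips_def sum_mono)
  also have "\<dots> = num_chips \<rho> + 1"
    using num_chips_add_delta[of \<rho> 1 i] by (simp add: num_chips_add_laplacian s_def)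
  finally show ?thesis .
qed

text \<open>
  Equivalence is invariant under translation, so uniqueness of representatives makes the
  operator injective on the finite set of recurrent sandpiles.
\<close>

lemma bij_betw_open_add_op: "bij_betw (open_add_op G z i) (Rec G z) (Rec G z)"
proof -
  have "inj_on (open_add_op G z i) (Rec G z)"
  proof (rule inj_onI)
    fix \<rho> \<sigma> assume *: "\<rho> \<in> Rec G z" "\<sigma> \<in> Rec G z" "open_add_op G z i \<rho> = open_add_op G z i \<sigma>"
    then have "equiv_off_sink z (\<lambda>j. \<rho> j + delta i j) (\<lambda>j. \<sigma> j + delta i j)"
      by (metis equiv_off_sink_sym equiv_off_sink_trans equiv_open_add_op)
    then show "\<rho> = \<sigma>"
      using * by (simp add: equiv_off_sink_add Rec_unique)
  qed
  then show ?thesis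
    by (metis bij_betw_imageI endo_inj_surj finite_Rec image_subsetI open_add_op_in_Rec)
qed

abbreviation open_sub_op :: "'v \<Rightarrow> 'v \<Rightarrow> 'v sandpile \<Rightarrow> 'v sandpile" where
  "open_sub_op z i \<equiv> inv_into (Rec G z) (open_add_op G z i)"

lemma bij_betw_open_sub_op: "bij_betw (open_sub_op z i) (Rec G z) (Rec G z)"
  by (rule bij_betw_inv_into[OF bij_betw_open_add_op])

lemma open_sub_op_in_Rec: "\<rho> \<in> Rec G z \<Longrightarrow> open_sub_op z i \<rho> \<in> Rec G z"
  using bij_betw_open_sub_op bij_betw_apply by metis

lemma open_add_op_eq_iff:
  "\<rho> \<in> Rec G z \<Longrightarrow> \<sigma> \<in> Rec G z \<Longrightarrow> open_add_op G z i \<rho> = \<sigma> \<longleftrightarrow> \<rho> = open_sub_op z i \<sigma>"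
  using bij_betw_open_add_op[of z i] by (metis bij_betw_inv_into_left bij_betw_inv_into_right)

lemma open_add_op_sink: "\<rho> \<in> Rec G z \<Longrightarrow> open_add_op G z z \<rho> = \<rho>"
proof -
  assume \<rho>: "\<rho> \<in> Rec G z"
  have "equiv_off_sink z (\<lambda>j. \<rho> j + delta z j) \<rho>"
    by (rule equiv_off_sinkI[where v = "\<lambda>_. 0"]) (simp add: delta_def)
  then have "equiv_off_sink z (open_add_op G z z \<rho>) \<rho>"
    using equiv_open_add_op[OF \<rho>] equiv_off_sink_sym equiv_off_sink_trans by blast
  then show ?thesis
    using \<rho> by (intro Rec_unique[where z = z] open_add_op_in_Rec)
qed

definition open_steps :: "'v \<Rightarrow> ('v sandpile \<times> 'v sandpile) set" where
  "open_steps z = {(\<rho>, open_add_op G z i \<rho>) | \<rho> i. \<rho> \<in> Rec G z}"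

lemma open_steps_rec_rep_add:
  assumes "\<And>j. n j \<ge> 0"
  shows "(rec_rep G z s, rec_rep G z (\<lambda>j. s j + n j)) \<in> (open_steps z)\<^sup>*"
  using assms
proof (induction "nat (num_chips n)" arbitrary: n)
  case 0
  then have "num_chips n = 0"
    using sum_nonneg[of UNIV n] by (simp add: num_chips_def)
  then have "n j = 0" for j
    using 0(2) by (simp add: num_chips_def sum_nonneg_eq_0_iff)
  then show ?case by simp
next
  case (Suc k)
  have "num_chips n > 0"
    using Suc.hyps(2) by linarith
  then obtain i where i: "n i \<ge> 1"
    unfolding num_chips_def by (metis int_one_le_iff_zero_less not_le sum_nonpos)
  define n' where "n' = (\<lambda>j. n j - delta i j)"
  have "k = nat (num_chips n')"
    using Suc.hyps(2) num_chips_add_delta[of n "-1" i] by (simp add: n'_def)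
  moreover have "n' j \<ge> 0" for j
    using i Suc.prems[of j] by (auto simp: n'_def delta_def)
  ultimately have "(rec_rep G z s, rec_rep G z (\<lambda>j. s j + n' j)) \<in> (open_steps z)\<^sup>*"
    by (rule Suc.hyps(1))
  moreover have "(\<lambda>j. s j + n j) = (\<lambda>j. (s j + n' j) + delta i j)"
    by (simp add: n'_def)
  then have "rec_rep G z (\<lambda>j. s j + n j) = open_add_op G z i (rec_rep G z (\<lambda>j. s j + n' j))"
    by (simp only: rec_rep_add_delta)
  then have "(rec_rep G z (\<lambda>j. s j + n' j), rec_rep G z (\<lambda>j. s j + n j)) \<in> open_steps z"
    using rec_rep_in_Rec by (auto simp: open_steps_def)
  ultimately show ?case
    by (rule rtrancl_into_rtrancl)
qed

text \<open>
  Replace the target \<open>\<sigma>\<close> by an equivalent sandpile that dominates \<open>\<rho>\<close>; adding the difference to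
  \<open>\<rho>\<close> chip by chip is a walk to \<open>\<sigma>\<close>.
\<close>

lemma open_steps_irreducible:
  assumes "\<rho> \<in> Rec G z" "\<sigma> \<in> Rec G z"
  shows "(\<rho>, \<sigma>) \<in> (open_steps z)\<^sup>*"
proof -
  obtain s where s: "equiv_off_sink z \<sigma> s" "\<And>j. j \<noteq> z \<Longrightarrow> s j \<ge> \<rho> j" "s z = \<sigma> z"
    using ex_equiv_ge[of z \<sigma> \<rho>] by blast
  have "s j - \<rho> j \<ge> 0" for j
    using s assms by (cases "j = z") (auto simp: Rec_iff)
  then have "(rec_rep G z \<rho>, rec_rep G z s) \<in> (open_steps z)\<^sup>*"
    using open_steps_rec_rep_add[of "\<lambda>j. s j - \<rho> j" z \<rho>] by simp
  moreover have "rec_rep G z \<rho> = \<rho>" "rec_rep G z s = \<sigma>"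
    using assms s equiv_off_sink_refl equiv_off_sink_sym by (auto intro!: rec_rep_eq)
  ultimately show ?thesis
    by simp
qed


section \<open>The closed chain and its threshold\<close>

lemma num_chips_chain: "num_chips (chain G s0 x k) = num_chips s0 + int k"
proof (induction k)
  case (Suc k)
  obtain w where "add_op G (x k) (chain G s0 x k)
      = (\<lambda>j. chain G s0 x k j + delta (x k) j + laplacian G w j)"
    using add_op_eq_add_laplacian by blast
  then show ?case
    using Suc num_chips_add_delta[of "chain G s0 x k" 1 "x k"] by (simp add: num_chips_add_laplacian)
qed simp

lemma rec_rep_chain:
  "rec_rep G z (chain G s0 x k) = driven_orbit (open_add_op G z) (rec_rep G z s0) x k"
proof (induction k)
  case (Suc k)
  obtain w where w: "add_op G (x k) (chain G s0 x k)
      = (\<lambda>j. chain G s0 x k j + delta (x k) j + laplacian G w j)"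
    using add_op_eq_add_laplacian by blast
  have "equiv_off_sink z (add_op G (x k) (chain G s0 x k)) (\<lambda>j. chain G s0 x k j + delta (x k) j)"
    by (rule equiv_off_sinkI[where v = w]) (simp add: w)
  then show ?case
    by (simp add: rec_rep_cong[of z "add_op G (x k) (chain G s0 x k)"] rec_rep_add_delta Suc)
qed simp

text \<open>
  A state is not stabilizable if and only if the chips catch up with the representative
  (\<open>over\<close> in the proof), and once this has happened it persists, as a step raises the number of
  chips of the representative by at most one. So the threshold time is \<open>k + 1\<close> if and only if the
  condition fails at \<open>k\<close> and holds at \<open>k + 1\<close>.
\<close>

lemma threshold_at_Suc_iff:
  fixes x :: "nat \<Rightarrow> 'v"
  assumes neg: "num_chips s0 < 0" and \<rho>: "\<rho> \<in> Rec G z"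
  shows "threshold_time G s0 x = Suc k \<and> rec_rep G z (threshold_state G s0 x) = \<rho> \<longleftrightarrow>
      num_chips \<rho> \<le> num_chips s0 + int k + 1 \<and>
      num_chips s0 + int k < num_chips (open_sub_op z (x k) \<rho>) \<and>
      driven_orbit (open_add_op G z) (rec_rep G z s0) x k = open_sub_op z (x k) \<rho>"
    and "threshold_time G s0 x > 0"
proof -
  define y where "y = driven_orbit (open_add_op G z) (rec_rep G z s0) x"
  define over where "over k \<longleftrightarrow> num_chips (y k) \<le> num_chips s0 + int k" for k
  have unstabilizable: "\<not> stabilizable G {} (chain G s0 x k) \<longleftrightarrow> over k" for k
    by (simp add: stabilizable_iff_num_chips[of _ z] rec_rep_chain num_chips_chain over_def y_def not_less)
  have y_Rec: "y k \<in> Rec G z" for k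
    unfolding y_def rec_rep_chain[symmetric] by (rule rec_rep_in_Rec)
  have y_Suc: "y (Suc k) = open_add_op G z (x k) (y k)" for k
    by (simp add: y_def)
  have over_Suc: "over (Suc k)" if "over k" for k
    using num_chips_open_add_op[OF y_Rec, of "x k" k] that by (simp add: over_def y_Suc)
  have mono: "over l" if "over k" "k \<le> l" for k l
    using that(2) by (induction rule: dec_induct) (auto intro: that(1) over_Suc)
  define \<tau> where "\<tau> = threshold_time G s0 x"
  have \<tau>_Least: "\<tau> = (LEAST k. over k)"
    by (simp add: \<tau>_def threshold_time_def unstabilizable)
  \<comment> \<open>The representative has at most as many chips as the sum of all degrees, so it is caught.\<close>
  have "over (nat ((\<Sum>i\<in>UNIV. deg G i) - num_chips s0))"
    using num_chips_Rec_le[OF y_Rec, of "nat ((\<Sum>i\<in>UNIV. deg G i) - num_chips s0)"]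
    unfolding over_def by linarith
  then have over_\<tau>: "over \<tau>"
    unfolding \<tau>_Least by (rule LeastI)
  have \<tau>_eq: "\<tau> = Suc k" if "\<not> over k" "over (Suc k)" for k
    unfolding \<tau>_Least
  proof (rule Least_equality)
    fix l assume "over l"
    then show "Suc k \<le> l"
      using mono[of l k] that by (cases "l \<le> k") auto
  qed fact
  have "\<not> over 0"
    using num_chips_Rec_nonneg[OF y_Rec, of 0] neg by (simp add: over_def)
  have state: "rec_rep G z (threshold_state G s0 x) = y \<tau>"
    by (simp add: threshold_state_def rec_rep_chain y_def \<tau>_def)
  have "num_chips \<rho> \<le> num_chips s0 + int k + 1 \<and>
      num_chips s0 + int k < num_chips (open_sub_op z (x k) \<rho>) \<and> y k = open_sub_op z (x k) \<rho>
    \<longleftrightarrow> over (Suc k) \<and> \<not> over k \<and> y (Suc k) = \<rho>"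
    using open_add_op_eq_iff[OF y_Rec \<rho>, of "x k" k] by (auto simp: over_def y_Suc algebra_simps)
  moreover have "\<not> over k" if "\<tau> = Suc k"
    using not_less_Least[of k over] that \<tau>_Least by simp
  ultimately show "threshold_time G s0 x = Suc k \<and> rec_rep G z (threshold_state G s0 x) = \<rho> \<longleftrightarrow>
      num_chips \<rho> \<le> num_chips s0 + int k + 1 \<and>
      num_chips s0 + int k < num_chips (open_sub_op z (x k) \<rho>) \<and>
      driven_orbit (open_add_op G z) (rec_rep G z s0) x k = open_sub_op z (x k) \<rho>"
    unfolding state y_def[symmetric] \<tau>_def[symmetric] using over_\<tau> \<tau>_eq[of k] by auto
  show "threshold_time G s0 x > 0"
    using over_\<tau> \<open>\<not> over 0\<close> unfolding \<tau>_def[symmetric] by (cases \<tau>) auto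
qed

lemma permutation_walk_Rec:
  assumes "\<And>i. pmf \<alpha> i > 0"
  shows "permutation_walk (Rec G z) (open_add_op G z) (pmf \<alpha>) z"
proof
  show "(\<Sum>i\<in>UNIV. pmf \<alpha> i) = 1"
    by (rule sum_pmf_eq_1) auto
  show "(\<rho>, \<sigma>) \<in> {(\<rho>, open_add_op G z i \<rho>) |\<rho> i. \<rho> \<in> Rec G z}\<^sup>*"
    if "\<rho> \<in> Rec G z" "\<sigma> \<in> Rec G z" for \<rho> \<sigma>
    using open_steps_irreducible[OF that] by (simp add: open_steps_def)
qed (use assms in \<open>auto simp: finite_Rec bij_betw_open_add_op open_add_op_sink\<close>)

text \<open>
  The times \<open>k\<close> at which adding a chip at \<open>i\<close> can make a chain that started with \<open>c\<close> chips reach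
  its threshold in the class of \<open>\<rho>\<close>.
\<close>

definition threshold_window :: "'v \<Rightarrow> 'v sandpile \<Rightarrow> int \<Rightarrow> 'v \<Rightarrow> nat set" where
  "threshold_window z \<rho> c i = {nat (num_chips \<rho> - c - 1)..<nat (num_chips (open_sub_op z i \<rho>) - c)}"

lemma finite_threshold_window: "finite (threshold_window z \<rho> c i)"
  by (simp add: threshold_window_def)

lemma mem_threshold_window_iff:
  "k \<in> threshold_window z \<rho> c i \<longleftrightarrow>
    num_chips \<rho> \<le> c + int k + 1 \<and> c + int k < num_chips (open_sub_op z i \<rho>)"
  by (auto simp: threshold_window_def)

lemma burst_size_nonneg:
  assumes "\<rho> \<in> Rec G z"
  shows "0 \<le> burst_size G z i \<rho>"
  using num_chips_open_add_op[OF open_sub_op_in_Rec[OF assms], of i i]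
    open_add_op_eq_iff[OF open_sub_op_in_Rec[OF assms] assms, of i i]
  by (simp add: burst_size_def)

text \<open>
  For \<open>c < 0\<close> the window lies entirely in the nonnegative times, and no time is cut off by the
  truncation to natural numbers.
\<close>

lemma card_threshold_window:
  assumes "\<rho> \<in> Rec G z" "c < 0"
  shows "real (card (threshold_window z \<rho> c i)) = real_of_int (burst_size G z i \<rho>)"
  using num_chips_Rec_nonneg[OF assms(1)] burst_size_nonneg[OF assms(1), of i] assms(2)
  by (simp add: threshold_window_def burst_size_def nat_diff_distrib')

text \<open>
  The event is the disjoint union, over the vertex \<open>i\<close> and the times \<open>k\<close> of its window, of the
  events that the walk is at the preimage of \<open>\<rho>\<close> at time \<open>k\<close> and that \<open>i\<close> is chosen next. An
  outcome determines \<open>k\<close> by the threshold time, and \<open>i\<close> as the vertex chosen then.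
\<close>

lemma prob_threshold_state:
  assumes neg: "num_chips s0 < 0" and \<rho>: "\<rho> \<in> Rec G z"
    and pos: "\<And>i. pmf \<alpha> i > 0"
    and M: "prob_space M" "prob_space.indep_vars M (\<lambda>_. count_space UNIV) X UNIV"
    and law: "\<And>k. distr M (count_space UNIV) (X k) = measure_pmf \<alpha>"
  shows "measure M {\<omega> \<in> space M. rec_rep G z (threshold_state G s0 (\<lambda>k. X k \<omega>)) = \<rho>} =
    (\<Sum>i\<in>UNIV. \<Sum>k\<in>threshold_window z \<rho> (num_chips s0) i.
      (permutation_walk.step (Rec G z) (open_add_op G z) (pmf \<alpha>) ^^ k)
        (indicator {rec_rep G z s0}) (open_sub_op z i \<rho>) * pmf \<alpha> i)"
proof -
  interpret W: permutation_walk "Rec G z" "open_add_op G z" "pmf \<alpha>" z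
    by (rule permutation_walk_Rec) (rule pos)
  interpret prob_space M by fact
  have rv: "X j \<in> measurable M (count_space UNIV)" for j
    using M(2) by (auto simp: indep_vars_def)
  have law': "prob (X k -` {i} \<inter> space M) = pmf \<alpha> i" for k i
    using measure_distr[OF rv, of "{i}" k] by (simp add: law measure_pmf_single)
  define x where "x \<omega> = (\<lambda>k. X k \<omega>)" for \<omega>
  define I where "I = (SIGMA i:UNIV. threshold_window z \<rho> (num_chips s0) i)"
  define A where "A p = {\<omega> \<in> space M.
      driven_orbit (open_add_op G z) (rec_rep G z s0) (\<lambda>k. X k \<omega>) (snd p) = open_sub_op z (fst p) \<rho> \<and>
      (\<forall>j\<in>{snd p}. X j \<omega> = fst p)}" for p
  have A: "A p \<in> events \<and> prob (A p) = (W.step ^^ snd p) (indicator {rec_rep G z s0}) (open_sub_op z (fst p) \<rho>) * pmf \<alpha> (fst p)"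
    for p
    unfolding A_def
    using W.prob_driven_orbit[OF M law' rec_rep_in_Rec open_sub_op_in_Rec[OF \<rho>],
        of "{snd p}" "snd p" s0 "fst p" "\<lambda>_. fst p"] by simp
  have A_iff: "\<omega> \<in> A p \<and> p \<in> I \<longleftrightarrow> \<omega> \<in> space M \<and> fst p = X (snd p) \<omega> \<and>
      threshold_time G s0 (x \<omega>) = Suc (snd p) \<and> rec_rep G z (threshold_state G s0 (x \<omega>)) = \<rho>" for \<omega> p
    unfolding threshold_at_Suc_iff(1)[OF neg \<rho>]
    by (cases p) (auto simp: A_def I_def x_def mem_threshold_window_iff)
  have "disjoint_family_on A I"
    unfolding disjoint_family_on_def
  proof (intro ballI impI)
    fix p q assume "p \<in> I" "q \<in> I" "p \<noteq> q"
    then show "A p \<inter> A q = {}"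
      using A_iff[of _ p] A_iff[of _ q] by (fastforce simp: prod_eq_iff)
  qed
  moreover have "finite I"
    by (simp add: I_def finite_threshold_window)
  ultimately have "prob (\<Union>p\<in>I. A p) = (\<Sum>p\<in>I. prob (A p))"
    using A by (intro finite_measure_finite_Union) auto
  moreover have "{\<omega> \<in> space M. rec_rep G z (threshold_state G s0 (x \<omega>)) = \<rho>} = (\<Union>p\<in>I. A p)"
  proof (intro equalityI subsetI)
    fix \<omega> assume \<omega>: "\<omega> \<in> {\<omega> \<in> space M. rec_rep G z (threshold_state G s0 (x \<omega>)) = \<rho>}"
    obtain k where "threshold_time G s0 (x \<omega>) = Suc k"
      using threshold_at_Suc_iff(2)[OF neg \<rho>] gr0_implies_Suc by blast
    then have "\<omega> \<in> A (X k \<omega>, k) \<and> (X k \<omega>, k) \<in> I"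
      using \<omega> unfolding A_iff by simp
    then show "\<omega> \<in> (\<Union>p\<in>I. A p)" by blast
  next
    fix \<omega> assume "\<omega> \<in> (\<Union>p\<in>I. A p)"
    then show "\<omega> \<in> {\<omega> \<in> space M. rec_rep G z (threshold_state G s0 (x \<omega>)) = \<rho>}"
      using A_iff by blast
  qed
  ultimately show ?thesis
    using A by (subst sum.Sigma) (auto simp: x_def I_def finite_threshold_window case_prod_beta)
qed

end

theorem corollary6:
  fixes G :: "('v::finite, 'e) pre_digraph"
    and \<alpha> :: "'v pmf"
    and M :: "'w measure"
    and X :: "nat \<Rightarrow> 'w \<Rightarrow> 'v"
    and z :: 'v
    and \<rho> :: "'v sandpile"
  assumes "fin_digraph G" and "verts G = UNIV"
    and "Digraph_Component.connected G"
    and "\<And>i. in_degree G i = out_degree G i"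
    and "\<And>i. pmf \<alpha> i > 0"
    and "prob_space M"
    and "prob_space.indep_vars M (\<lambda>_. count_space UNIV) X UNIV"
    and "\<And>k. distr M (count_space UNIV) (X k) = measure_pmf \<alpha>"
    and "\<rho> \<in> Rec G z"
  shows "\<forall>\<epsilon>>0. \<exists>K<0. \<forall>s0 :: 'v sandpile. num_chips s0 < K \<longrightarrow>
    \<bar>measure M {\<omega> \<in> space M. rec_rep G z (threshold_state G s0 (\<lambda>k. X k \<omega>)) = \<rho>}
      - (1 / real (card (Rec G z))) * (\<Sum>i\<in>UNIV. pmf \<alpha> i * real_of_int (burst_size G z i \<rho>))\<bar> \<le> \<epsilon>"
proof (intro allI impI)
  fix \<epsilon> :: real assume "\<epsilon> > 0"
  interpret eulerian_graph G
    by (intro eulerian_graph.intro assms(1-4))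
  interpret W: permutation_walk "Rec G z" "open_add_op G z" "pmf \<alpha>" z
    by (rule permutation_walk_Rec) (rule assms(5))
  define \<kappa> where "\<kappa> = real (card (Rec G z))"
  define L where "L = (\<Sum>i\<in>UNIV. pmf \<alpha> i * real_of_int (burst_size G z i \<rho>))"
  have "L \<ge> 0"
    unfolding L_def using burst_size_nonneg[OF assms(9)] by (intro sum_nonneg mult_nonneg_nonneg) auto
  \<comment> \<open>An error of \<open>\<delta>\<close> in each transition probability adds up to \<open>\<delta> L\<close>; adding 1 covers \<open>L = 0\<close>.\<close>
  define \<delta> where "\<delta> = \<epsilon> / (L + 1)"
  have "\<delta> > 0"
    using \<open>\<epsilon> > 0\<close> \<open>L \<ge> 0\<close> by (simp add: \<delta>_def)
  define p where "p k y = (W.step ^^ k) (indicator {y})" for k y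
  have "\<forall>\<^sub>F k in sequentially. \<forall>y\<in>Rec G z. \<forall>\<sigma>\<in>Rec G z. \<bar>p k y \<sigma> - 1 / \<kappa>\<bar> < \<delta>"
  proof (intro eventually_ball_finite finite_Rec ballI)
    fix y \<sigma> assume y: "y \<in> Rec G z" and "\<sigma> \<in> Rec G z"
    have "(\<lambda>k. p k y \<sigma>) \<longlonglongrightarrow> (\<Sum>t\<in>Rec G z. indicator {y} t) / \<kappa>"
      unfolding p_def \<kappa>_def by (rule W.step_converges_to_average) fact
    also have "(\<Sum>t\<in>Rec G z. indicator {y} t) = (1 :: real)"
      using y finite_Rec[of z] by (simp add: indicator_def of_bool_def sum.delta)
    finally show "\<forall>\<^sub>F k in sequentially. \<bar>p k y \<sigma> - 1 / \<kappa>\<bar> < \<delta>"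
      using \<open>\<delta> > 0\<close> by (auto simp: tendsto_iff dist_real_def)
  qed
  then obtain k0 where k0: "\<And>k y \<sigma>. k \<ge> k0 \<Longrightarrow> y \<in> Rec G z \<Longrightarrow> \<sigma> \<in> Rec G z \<Longrightarrow> \<bar>p k y \<sigma> - 1 / \<kappa>\<bar> < \<delta>"
    unfolding eventually_sequentially by blast
  show "\<exists>K<0. \<forall>s0 :: 'v sandpile. num_chips s0 < K \<longrightarrow>
    \<bar>measure M {\<omega> \<in> space M. rec_rep G z (threshold_state G s0 (\<lambda>k. X k \<omega>)) = \<rho>}
      - (1 / real (card (Rec G z))) * (\<Sum>i\<in>UNIV. pmf \<alpha> i * real_of_int (burst_size G z i \<rho>))\<bar> \<le> \<epsilon>"
  \<comment> \<open>Every time \<open>k\<close> in a window satisfies \<open>k \<ge> |\<rho>| - |s\<^sub>0| - 1 \<ge> -|s\<^sub>0| - 1\<close>.\<close>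
  proof (intro exI[of _ "- int k0 - 1"] conjI allI impI)
    fix s0 :: "'v sandpile" assume s0: "num_chips s0 < - int k0 - 1"
    define y where "y = rec_rep G z s0"
    define W where "W = threshold_window z \<rho> (num_chips s0)"
    have neg: "num_chips s0 < 0"
      using s0 by simp
    have "1 / \<kappa> * L = (\<Sum>i\<in>UNIV. \<Sum>k\<in>W i. 1 / \<kappa> * pmf \<alpha> i)"
      using card_threshold_window[OF assms(9) neg] by (simp add: L_def W_def sum_distrib_left mult_ac)
    then have "measure M {\<omega> \<in> space M. rec_rep G z (threshold_state G s0 (\<lambda>k. X k \<omega>)) = \<rho>} - 1 / \<kappa> * L
      = (\<Sum>i\<in>UNIV. \<Sum>k\<in>W i. (p k y (open_sub_op z i \<rho>) - 1 / \<kappa>) * pmf \<alpha> i)"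
      using prob_threshold_state[OF neg assms(9,5-8)]
      by (simp add: p_def y_def W_def left_diff_distrib sum_subtractf)
    also have "\<bar>\<dots>\<bar> \<le> (\<Sum>i\<in>UNIV. \<Sum>k\<in>W i. \<delta> * pmf \<alpha> i)"
    proof (intro order.trans[OF sum_abs] sum_mono)
      fix i k assume "k \<in> W i"
      then have "k \<ge> k0"
        using s0 num_chips_Rec_nonneg[OF assms(9)] by (auto simp: W_def mem_threshold_window_iff)
      then have "\<bar>p k y (open_sub_op z i \<rho>) - 1 / \<kappa>\<bar> < \<delta>"
        by (intro k0) (auto simp: y_def rec_rep_in_Rec open_sub_op_in_Rec assms(9))
      then show "\<bar>(p k y (open_sub_op z i \<rho>) - 1 / \<kappa>) * pmf \<alpha> i\<bar> \<le> \<delta> * pmf \<alpha> i"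
        by (simp add: abs_mult mult_right_mono)
    qed
    also have "\<dots> = \<delta> * L"
      using card_threshold_window[OF assms(9) neg] by (simp add: L_def W_def sum_distrib_left mult_ac)
    also have "\<dots> \<le> \<epsilon>"
      using \<open>\<epsilon> > 0\<close> \<open>L \<ge> 0\<close> by (simp add: \<delta>_def field_simps)
    finally show "\<bar>measure M {\<omega> \<in> space M. rec_rep G z (threshold_state G s0 (\<lambda>k. X k \<omega>)) = \<rho>}
      - (1 / real (card (Rec G z))) * (\<Sum>i\<in>UNIV. pmf \<alpha> i * real_of_int (burst_size G z i \<rho>))\<bar> \<le> \<epsilon>"
      by (simp add: \<kappa>_def L_def)
  qed simp
qed

end
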